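(* Let $\{u_i\}_{i\in I}\subset H_\lambda$ be a family and set $u:=\sup_{i\in I}u_i$, $S:=\{z\in\mathbb{C}^n:u(z)<+\infty\}$. The following are equivalent: (1) $\sup_{B^n}u<+\infty$; (2) $u^*\in H_\lambda$; (3) there is $a\in\mathbb{C}^n$ with $u^*(a)<+\infty$; (4) there is an open ball $B^n(a;r)$ with $\sup_{B^n(a;r)}u<+\infty$; (5) $S$ is not $\lambda$-pluripolar.
   Context: Fix $\lambda=(\lambda_1,\dots,\lambda_n)$ with $\lambda_1=1$, $\lambda_k>0$. $\Phi^X(z,t)=(z_1e^{-\lambda_1t},\dots,z_ne^{-\lambda_nt})$. $B^n(a;r)$ is the open Euclidean ball, $B^n=B^n(0;1)$. $H_\lambda$ is the set of nonconstant plurisubharmonic functions $u\ge0$ on $\mathbb{C}^n$ with $u(\Phi^X(z,t))=e^{-\operatorname{Re}t}u(z)$ for all $z\in\mathbb{C}^n$, $t\in\mathbb{C}$. A set $E\subset\mathbb{C}^n$ is $\lambda$-pluripolar if there is $v\in H_\lambda$ with $E\subset\{v=0\}$. $u^*(z)=\limsup_{w\to z}u(w)$ is the upper-semicontinuous regularization. *)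

theory Defs
  imports "HOL-Analysis.Analysis"
begin

definition Phi :: "real^'n \<Rightarrow> complex^'n \<Rightarrow> complex \<Rightarrow> complex^'n" where
  "Phi lam z t = (\<chi> k. z$k * exp (- (complex_of_real (lam$k)) * t))"

definition circle_mean :: "(complex^'n \<Rightarrow> ereal) \<Rightarrow> complex^'n \<Rightarrow> complex^'n \<Rightarrow> ereal" where
  "circle_mean u a b =
     ereal (1 / (2 * pi)) *
       (enn2ereal (\<integral>\<^sup>+ \<theta>\<in>{0..2*pi}. e2ennreal (max 0 (u (a + exp (\<i> * complex_of_real \<theta>) *s b))) \<partial>lborel)
      - enn2ereal (\<integral>\<^sup>+ \<theta>\<in>{0..2*pi}. e2ennreal (max 0 (- u (a + exp (\<i> * complex_of_real \<theta>) *s b))) \<partial>lborel))"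

definition psh :: "(complex^'n \<Rightarrow> ereal) \<Rightarrow> bool" where
  "psh u \<longleftrightarrow> (\<forall>z. u z < \<infinity>) \<and> (\<forall>z. Limsup (at z) u \<le> u z)
     \<and> (\<forall>a b. u a \<le> circle_mean u a b)"

definition H_lam :: "real^'n \<Rightarrow> (complex^'n \<Rightarrow> ereal) set" where
  "H_lam lam = {u. psh u \<and> (\<exists>z w. u z \<noteq> u w) \<and> (\<forall>z. 0 \<le> u z)
      \<and> (\<forall>z t. u (Phi lam z t) = ereal (exp (- Re t)) * u z)}"

definition lam_pluripolar :: "real^'n \<Rightarrow> (complex^'n) set \<Rightarrow> bool" where
  "lam_pluripolar lam E \<longleftrightarrow> (\<exists>v\<in>H_lam lam. E \<subseteq> {z. v z = 0})"

text \<open>Upper semicontinuous regularization u^*(z) = limsup_{w -> z} u(w) (w = z allowed).\<close>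
definition usc_reg :: "('a::topological_space \<Rightarrow> ereal) \<Rightarrow> 'a \<Rightarrow> ereal" where
  "usc_reg u z = Limsup (nhds z) u"

end

theory Submission
  imports Defs "HOL-Complex_Analysis.Cauchy_Integral_Formula"
begin

text \<open>
  A homogeneous function \<open>u \<in> H_lam\<close> is logarithmically plurisubharmonic, because \<open>exp (- Re P) u\<close>
  restricted to a complex line is \<open>u\<close> restricted to an entire curve along the flow \<open>Phi\<close>. Hence
  weighted geometric means of members of \<open>H_lam\<close> with total weight \<open>1\<close> again belong to \<open>H_lam\<close>,
  as soon as they do not vanish identically.

  If the family is unbounded on the unit ball, choose \<open>u_j\<close> with maxima \<open>M_j \<ge> exp (2^(j+1))\<close>
  there and put \<open>v = \<Prod>j. (u_j / M_j) powr 2^-(j+1)\<close>. Then \<open>v\<close> vanishes wherever the family is bounded,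
  and \<open>v\<close> is not identically zero because the integrals of \<open>- ln (u_j / M_j)\<close> over a fixed ball are
  bounded uniformly in \<open>j\<close>. Conversely, a logarithmically plurisubharmonic function vanishing on a
  ball vanishes identically, as is seen on circles through that ball.
\<close>

section \<open>Upper semicontinuous functions and circle means\<close>

text \<open>A convergent sum of the normalised \<open>u_j\<close> would vanish only where all of
  them vanish. A product also vanishes where its factors merely stay small, which is why geometric
  means are needed. The threshold \<open>exp (2^(j+1))\<close> is matched to the weight
  \<open>2^-(j+1)\<close>: where the family is bounded, the \<open>j\<close>-th factor is at most
  \<open>exp (-1)\<close> times a power of the bound, and these powers have total exponent at most
  \<open>1\<close>. The obstacle is that plurisubharmonicity is available only as upper
  semicontinuity and the submean inequality on circles in affine complex lines, whereas the
  logarithmic step follows a curved entire disc. A maximum principle along entire curves is enough.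
  Read for \<open>- ln\<close>, with value infinity at zeros, the same comparison shows both that
  \<open>v\<close> is not identically zero and that vanishing on a ball spreads everywhere.\<close>

definition usc :: "('a::topological_space \<Rightarrow> real) \<Rightarrow> bool" where
  "usc f \<longleftrightarrow> (\<forall>z c. f z < c \<longrightarrow> (\<forall>\<^sub>F w in nhds z. f w < c))"

lemma uscD: "usc f \<Longrightarrow> f z < c \<Longrightarrow> \<forall>\<^sub>F w in nhds z. f w < c"
  by (simp add: usc_def)

lemma open_usc: "usc f \<Longrightarrow> open {z. f z < c}"
  by (subst open_subopen) (force simp: usc_def eventually_nhds)

lemma usc_borel_measurable: "usc f \<Longrightarrow> f \<in> borel_measurable borel"
  by (subst borel_measurable_iff_less) (simp add: borel_open open_usc)

lemma usc_compose:
  assumes "usc f" "continuous_on UNIV g"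
  shows "usc (\<lambda>x. f (g x))"
proof -
  have "\<forall>\<^sub>F w in nhds z. f (g w) < c" if "f (g z) < c" for z c
  proof -
    have "(g \<longlongrightarrow> g z) (nhds z)"
      using assms(2) by (simp add: continuous_on_def tendsto_at_iff_tendsto_nhds)
    then show ?thesis
      using uscD[OF assms(1) that] by (rule eventually_compose_filterlim[rotated])
  qed
  then show ?thesis by (simp add: usc_def)
qed

lemma usc_add_continuous:
  assumes "usc f" "continuous_on UNIV g"
  shows "usc (\<lambda>x. f x + g x)"
proof -
  have "\<forall>\<^sub>F w in nhds z. f w + g w < c" if "f z + g z < c" for z c
  proof -
    define d where "d = (c - f z - g z) / 2"
    have d: "d > 0" using that by (simp add: d_def)
    have "(g \<longlongrightarrow> g z) (nhds z)"
      using assms(2) by (simp add: continuous_on_def tendsto_at_iff_tendsto_nhds)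
    then have "\<forall>\<^sub>F w in nhds z. g w < g z + d"
      using d by (intro order_tendstoD) auto
    moreover have "\<forall>\<^sub>F w in nhds z. f w < f z + d"
      using d by (intro uscD[OF assms(1)]) auto
    ultimately show ?thesis
      by eventually_elim (auto simp: d_def field_simps)
  qed
  then show ?thesis by (simp add: usc_def)
qed

text \<open>If no point were maximal, the open sets \<open>{x. f x < f w}\<close> would cover
  \<open>K\<close>; among the finitely many \<open>w\<close> of a subcover, the one with the largest
  value lies in none of the chosen sets.\<close>

lemma usc_attains_sup:
  assumes f: "usc f" and K: "compact K" "K \<noteq> {}"
  shows "\<exists>z\<in>K. \<forall>w\<in>K. f w \<le> f z"
proof (rule ccontr)
  assume "\<not> ?thesis"
  then have *: "\<forall>z\<in>K. \<exists>w\<in>K. f z < f w" by (auto simp: not_le)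
  have "K \<subseteq> (\<Union>w\<in>K. {x. f x < f w})" using * by auto
  then obtain D where D: "D \<subseteq> K" "finite D" "K \<subseteq> (\<Union>w\<in>D. {x. f x < f w})"
    using compactE_image[OF K(1), of K "\<lambda>w. {x. f x < f w}"] open_usc[OF f] by metis
  then have "D \<noteq> {}" using K by auto
  then have "Max (f ` D) \<in> f ` D" using D(2) by (intro Max_in) auto
  then obtain w where "w \<in> D" "f w = Max (f ` D)" by auto
  then have w: "w \<in> D" "\<forall>x\<in>D. f x \<le> f w" using D(2) by auto
  with D show False by (force simp: not_less)
qed

lemma usc_bounded_on_compact:
  assumes "usc f" "compact K"
  shows "\<exists>M. \<forall>w\<in>K. f w \<le> M"
  using usc_attains_sup[OF assms] by (cases "K = {}") auto

lemma usc_mult_nonneg: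
  assumes "usc f" "usc g" "\<And>x. 0 \<le> f x" "\<And>x. 0 \<le> g x"
  shows "usc (\<lambda>x. f x * g x)"
proof -
  have "\<forall>\<^sub>F w in nhds z. f w * g w < c" if "f z * g z < c" for z c
  proof -
    have "((\<lambda>e. (f z + e) * (g z + e)) \<longlongrightarrow> (f z + 0) * (g z + 0)) (at_right 0)"
      by (intro tendsto_intros)
    then have "\<forall>\<^sub>F e in at_right 0. (f z + e) * (g z + e) < c \<and> e > 0"
      using that eventually_at_right_less[of "0::real"]
      by (intro eventually_conj order_tendstoD(2)[of _ "(f z + 0) * (g z + 0)"]) auto
    then obtain e where e: "(f z + e) * (g z + e) < c" "e > 0"
      by (auto dest: eventually_happens)
    have "\<forall>\<^sub>F w in nhds z. f w < f z + e" "\<forall>\<^sub>F w in nhds z. g w < g z + e"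
      using e assms by (auto intro!: uscD)
    then show ?thesis
    proof eventually_elim
      case (elim w)
      then have "f w * g w \<le> (f z + e) * (g z + e)"
        using assms(3,4) e(2) by (intro mult_mono) (auto intro: add_nonneg_nonneg)
      with e show ?case by linarith
    qed
  qed
  then show ?thesis by (simp add: usc_def)
qed

lemma usc_powr:
  assumes "usc f" "\<And>x. 0 \<le> f x" "0 < \<alpha>"
  shows "usc (\<lambda>x. f x powr \<alpha>)"
proof -
  have "\<forall>\<^sub>F w in nhds z. f w powr \<alpha> < c" if "f z powr \<alpha> < c" for z c
  proof -
    have "0 \<le> f z powr \<alpha>" by simp
    with that have c: "0 < c" by linarith
    have "f z < c powr (1/\<alpha>)"
    proof (rule ccontr)
      assume "\<not> f z < c powr (1/\<alpha>)"
      then have "(c powr (1/\<alpha>)) powr \<alpha> \<le> f z powr \<alpha>"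
        using assms(3) by (intro powr_mono2) auto
      with that c assms(3) show False by (simp add: powr_powr)
    qed
    then have "\<forall>\<^sub>F w in nhds z. f w < c powr (1/\<alpha>)" by (rule uscD[OF assms(1)])
    then show ?thesis
    proof eventually_elim
      case (elim w)
      then have "f w powr \<alpha> < (c powr (1/\<alpha>)) powr \<alpha>"
        using assms(2,3) by (intro powr_less_mono2) auto
      then show ?case using c assms(3) by (simp add: powr_powr)
    qed
  qed
  then show ?thesis by (simp add: usc_def)
qed

lemma usc_const: "usc (\<lambda>_. c)"
  by (simp add: usc_def)

lemma usc_prod_nonneg:
  assumes "\<And>i. i \<in> J \<Longrightarrow> usc (f i)" "\<And>i x. i \<in> J \<Longrightarrow> 0 \<le> f i x"
  shows "usc (\<lambda>x. \<Prod>i\<in>J. f i x)"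
  using assms
proof (induction J rule: infinite_finite_induct)
  case (insert i J)
  then show ?case by (simp add: usc_mult_nonneg prod_nonneg)
qed (auto simp: usc_const)

section \<open>The normalised measure on the circle\<close>

definition circ :: "real measure" where
  "circ = uniform_measure lborel {0..2*pi}"

lemma space_circ [simp]: "space circ = UNIV"
  and sets_circ [simp, measurable_cong]: "sets circ = sets borel"
  by (simp_all add: circ_def)

interpretation circ: finite_measure circ
proof
  have "emeasure circ (space circ) = 1"
    unfolding circ_def by (subst emeasure_uniform_measure) (auto simp: ennreal_divide_self)
  then show "emeasure circ (space circ) \<noteq> \<infinity>" by simp
qed

lemma emeasure_circ_UNIV [simp]: "emeasure circ UNIV = 1"
  unfolding circ_def by (subst emeasure_uniform_measure) (auto simp: ennreal_divide_self)

lemma measure_circ_UNIV [simp]: "measure circ UNIV = 1"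
  by (simp add: measure_def)

lemma integrable_circ_bounded:
  fixes f :: "real \<Rightarrow> 'a::{banach,second_countable_topology}"
  assumes "f \<in> borel_measurable borel" "\<And>x. norm (f x) \<le> B"
  shows "integrable circ f"
  by (rule circ.integrable_const_bound[of _ B]) (use assms in auto)

lemma has_bochner_integral_circ_const: "has_bochner_integral circ (\<lambda>_. c::real) c"
  by (simp add: has_bochner_integral_iff)

lemma integral_circ:
  fixes f :: "real \<Rightarrow> 'a::{banach,second_countable_topology}"
  assumes "f \<in> borel_measurable borel"
  shows "(\<integral>\<theta>. f \<theta> \<partial>circ) = (\<integral>\<theta>. indicator {0..2*pi} \<theta> *\<^sub>R f \<theta> \<partial>lborel) /\<^sub>R (2*pi)"
proof -
  have *: "circ = density lborel (\<lambda>x. ennreal (indicator {0..2*pi} x / (2*pi)))"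
    unfolding circ_def uniform_measure_def
    by (rule density_cong) (auto simp: indicator_def divide_ennreal simp flip: ennreal_1)
  then have "(\<integral>\<theta>. f \<theta> \<partial>circ) = (\<integral>\<theta>. (indicator {0..2*pi} \<theta> / (2*pi)) *\<^sub>R f \<theta> \<partial>lborel)"
    unfolding * using assms by (subst integral_density) auto
  also have "\<dots> = (\<integral>\<theta>. (1/(2*pi)) *\<^sub>R (indicator {0..2*pi} \<theta> *\<^sub>R f \<theta>) \<partial>lborel)"
    by (simp add: field_simps)
  also have "\<dots> = (\<integral>\<theta>. indicator {0..2*pi} \<theta> *\<^sub>R f \<theta> \<partial>lborel) /\<^sub>R (2*pi)"
    by (subst integral_scaleR_right) (simp add: field_simps)
  finally show ?thesis .
qed

lemma holomorphic_circ_mean: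
  assumes P: "P holomorphic_on UNIV" and r: "0 < r"
  shows "(\<integral>\<theta>. P (z + of_real r * cis \<theta>) \<partial>circ) = P z"
proof -
  let ?g = "\<lambda>\<theta>. P (z + of_real r * cis \<theta>)"
  have contP: "continuous_on UNIV P" using P by (rule holomorphic_on_imp_continuous_on)
  have cont: "continuous_on UNIV ?g"
    by (rule continuous_on_compose2[OF contP]) (auto intro!: continuous_intros)
  have "((\<lambda>u. P u / (u - z)) has_contour_integral (2 * of_real pi * \<i> * P z)) (part_circlepath z r 0 (2*pi))"
    using Cauchy_integral_circlepath_simple[of P z r z] P r holomorphic_on_subset
    unfolding circlepath_def by force
  then have "((\<lambda>t. P (z + r * cis t) / (r * cis t) * r * \<i> * cis t) has_integral (2 * of_real pi * \<i> * P z)) {0..2*pi}"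
    by (subst (asm) has_contour_integral_part_circlepath_iff) auto
  \<comment> \<open>The derivative of the parametrisation is \<open>\<i>\<close> times the
    displacement from the centre, so the Cauchy kernel cancels and only the factor
    \<open>\<i>\<close> survives.\<close>
  also have "(\<lambda>t. P (z + r * cis t) / (r * cis t) * r * \<i> * cis t) = (\<lambda>t. \<i> * ?g t)"
    using r by (auto simp: fun_eq_iff)
  finally have "((\<lambda>t. (- \<i>) * (\<i> * ?g t)) has_integral ((- \<i>) * (2 * of_real pi * \<i> * P z))) {0..2*pi}"
    by (rule has_integral_mult_right)
  then have *: "(?g has_integral (2 * of_real pi * P z)) {0..2*pi}"
    by (simp add: mult.assoc[symmetric]) (simp add: mult.assoc mult.left_commute)
  have "set_integrable lborel {0..2*pi} ?g"
    by (rule borel_integrable_compact[unfolded set_integrable_def[symmetric]])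
       (auto intro: continuous_on_subset[OF cont])
  then have "(LINT x:{0..2*pi}|lborel. ?g x) = 2 * of_real pi * P z"
    using * set_borel_integral_eq_integral(2) integral_unique by metis
  moreover have "?g \<in> borel_measurable borel"
    using cont by (rule borel_measurable_continuous_onI)
  ultimately show ?thesis
    by (simp add: integral_circ set_lebesgue_integral_def scaleR_conv_of_real)
qed

text \<open>Uniqueness of Haar measure, by applying Fubini to the convolution of two translation
  invariant measures over the unit ball.\<close>

lemma lborel_distr_isometry:
  fixes T :: "'a::euclidean_space \<Rightarrow> 'a"
  assumes lin: "linear T" and iso: "\<And>x. norm (T x) = norm x"
  shows "distr lborel borel T = lborel"
proof -
  have [measurable]: "T \<in> borel \<rightarrow>\<^sub>M borel"
    using lin by (intro borel_measurable_continuous_onI linear_continuous_on linear_conv_bounded_linear[THEN iffD1])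
  define M where "M = distr lborel borel T"
  have [simp]: "space M = UNIV" and [measurable_cong]: "sets M = sets borel"
    by (auto simp: M_def)
  have "inj T"
    using iso lin by (metis linear_injective_0 norm_eq_zero)
  then have surj: "surj T" using lin linear_injective_imp_surjective by blast
  have transl: "(\<integral>\<^sup>+x. g (y + x) \<partial>M) = (\<integral>\<^sup>+x. g x \<partial>M)"
    if [measurable]: "g \<in> borel_measurable borel" for g y
  proof -
    obtain y' where y': "y = T y'" using surj by auto
    have "(\<integral>\<^sup>+x. g (y + x) \<partial>M) = (\<integral>\<^sup>+x. g (T (y' + x)) \<partial>lborel)"
      by (simp add: M_def nn_integral_distr y' linear_add[OF lin])
    also have "\<dots> = (\<integral>\<^sup>+x. g (T x) \<partial>distr lborel borel ((+) y'))"
      by (subst nn_integral_distr) auto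
    also have "\<dots> = (\<integral>\<^sup>+x. g x \<partial>M)"
      by (simp add: M_def nn_integral_distr lborel_distr_plus)
    finally show ?thesis .
  qed
  have lin_transl: "(\<integral>\<^sup>+x. g (y + x) \<partial>lborel) = (\<integral>\<^sup>+x. g x \<partial>lborel)"
    if [measurable]: "g \<in> borel_measurable borel" for g :: "'a \<Rightarrow> ennreal" and y
  proof -
    have "(\<integral>\<^sup>+x. g (y + x) \<partial>lborel) = (\<integral>\<^sup>+x. g x \<partial>distr lborel borel ((+) y))"
      by (subst nn_integral_distr) auto
    then show ?thesis by (simp add: lborel_distr_plus)
  qed
  let ?B = "ball (0::'a) 1"
  \<comment> \<open>An isometry preserves balls about the origin. This makes \<open>M\<close>
    sigma-finite and later fixes the constant of proportionality between the two measures.\<close>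
  have ballM: "emeasure M (ball 0 e) = emeasure lborel (ball (0::'a) e)" for e
  proof -
    have "T -` ball 0 e = ball 0 e" by (auto simp: iso)
    then show ?thesis by (simp add: M_def emeasure_distr)
  qed
  interpret M: sigma_finite_measure M
  proof
    show "\<exists>A. countable A \<and> A \<subseteq> sets M \<and> \<Union>A = space M \<and> (\<forall>a\<in>A. emeasure M a \<noteq> \<infinity>)"
    proof (intro exI[of _ "range (\<lambda>n::nat. ball 0 (real n))"] conjI)
      show "\<Union> (range (\<lambda>n::nat. ball (0::'a) (real n))) = space M"
        by (auto intro: reals_Archimedean2)
      show "\<forall>A\<in>range (\<lambda>n::nat. ball 0 (real n)). emeasure M A \<noteq> \<infinity>"
        using emeasure_lborel_ball_finite[of "0::'a"] by (auto simp: ballM less_top)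
    qed (auto simp: \<open>sets M = sets borel\<close>)
  qed
  interpret P: pair_sigma_finite lborel M ..
  have B0: "emeasure lborel ?B \<noteq> 0"
    using content_ball_pos[of 1 "0::'a"] emeasure_lborel_ball_finite[of "0::'a" 1]
    by (auto simp: measure_def)
  have Bfin: "emeasure lborel ?B \<noteq> \<infinity>"
    using emeasure_lborel_ball_finite[of "0::'a" 1] by auto
  have "emeasure M A = emeasure lborel A" if [measurable]: "A \<in> sets borel" for A
  proof -
    have fs: "fst \<in> lborel \<Otimes>\<^sub>M M \<rightarrow>\<^sub>M borel" "snd \<in> lborel \<Otimes>\<^sub>M M \<rightarrow>\<^sub>M borel"
      by measurable
    have iA: "(indicator A :: 'a \<Rightarrow> ennreal) \<in> borel_measurable borel"
      and iB: "(indicator ?B :: 'a \<Rightarrow> ennreal) \<in> borel_measurable borel"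
      by (rule borel_measurable_indicator[OF that], rule borel_measurable_indicator[OF borel_open[OF open_ball]])
    have m1: "(\<lambda>(y, x). indicator ?B y * indicator A (y + x) :: ennreal) \<in> borel_measurable (lborel \<Otimes>\<^sub>M M)"
      unfolding case_prod_beta
      by (intro borel_measurable_times_ennreal measurable_compose[OF _ iA] measurable_compose[OF _ iB]
          borel_measurable_add fs)
    have m2: "(\<lambda>(y, x). indicator ?B (- x + y) * indicator A (- x + y + x) :: ennreal) \<in> borel_measurable (lborel \<Otimes>\<^sub>M M)"
      unfolding case_prod_beta
      by (intro borel_measurable_times_ennreal measurable_compose[OF _ iA] measurable_compose[OF _ iB]
          borel_measurable_add borel_measurable_uminus fs)
    have m3: "(\<lambda>y. indicator ?B y * indicator A (y + x) :: ennreal) \<in> borel_measurable borel" for x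
      by (intro borel_measurable_times_ennreal iB measurable_compose[OF _ iA] borel_measurable_add) auto
    have m4: "(\<lambda>x. indicator ?B (- y + x) :: ennreal) \<in> borel_measurable borel" for y
      by (intro measurable_compose[OF _ iB] borel_measurable_add) auto
    have "emeasure M A * emeasure lborel ?B = (\<integral>\<^sup>+y. indicator ?B y * (\<integral>\<^sup>+x. indicator A x \<partial>M) \<partial>lborel)"
      by (subst nn_integral_multc) (simp_all add: borel_measurable_indicator mult.commute)
    also have "\<dots> = (\<integral>\<^sup>+y. indicator ?B y * (\<integral>\<^sup>+x. indicator A (y + x) \<partial>M) \<partial>lborel)"
      by (subst transl) auto
    also have "\<dots> = (\<integral>\<^sup>+y. (\<integral>\<^sup>+x. indicator ?B y * indicator A (y + x) \<partial>M) \<partial>lborel)"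
      by (subst nn_integral_cmult) auto
    also have "\<dots> = (\<integral>\<^sup>+x. (\<integral>\<^sup>+y. indicator ?B y * indicator A (y + x) \<partial>lborel) \<partial>M)"
      by (rule P.Fubini'[symmetric, OF m1])
    also have "\<dots> = (\<integral>\<^sup>+x. (\<integral>\<^sup>+y. indicator ?B (- x + y) * indicator A (- x + y + x) \<partial>lborel) \<partial>M)"
      by (intro nn_integral_cong lin_transl[OF m3, symmetric])
    also have "\<dots> = (\<integral>\<^sup>+y. (\<integral>\<^sup>+x. indicator ?B (- x + y) * indicator A (- x + y + x) \<partial>M) \<partial>lborel)"
      by (rule P.Fubini'[OF m2])
    \<comment> \<open>The ball is symmetric, so \<open>- x + y\<close> may be replaced by
      \<open>- y + x\<close>; in this form translation invariance of \<open>M\<close> applies to the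
      inner integral.\<close>
    also have "\<dots> = (\<integral>\<^sup>+y. (\<integral>\<^sup>+x. indicator A y * indicator ?B (- y + x) \<partial>M) \<partial>lborel)"
      by (intro nn_integral_cong) (auto simp: indicator_def dist_norm norm_minus_commute)
    also have "\<dots> = (\<integral>\<^sup>+y. indicator A y * (\<integral>\<^sup>+x. indicator ?B (- y + x) \<partial>M) \<partial>lborel)"
      by (intro nn_integral_cong nn_integral_cmult) (simp only: m4 measurable_cong_sets[OF \<open>sets M = sets borel\<close> refl])
    also have "\<dots> = (\<integral>\<^sup>+y. indicator A y * (\<integral>\<^sup>+x. indicator ?B x \<partial>M) \<partial>lborel)"
      by (subst transl[OF iB]) simp
    also have "\<dots> = emeasure lborel A * emeasure lborel ?B"
      by (simp add: nn_integral_multc ballM)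
    finally have "emeasure lborel ?B * emeasure M A = emeasure lborel ?B * emeasure lborel A"
      by (simp only: mult.commute[of "emeasure lborel ?B"])
    then show ?thesis
      unfolding ennreal_mult_cancel_left using B0 Bfin by simp
  qed
  then have "M = lborel"
    by (intro measure_eqI) (auto simp: \<open>sets M = sets borel\<close>)
  then show ?thesis by (simp add: M_def)
qed

section \<open>The maximum principle along entire curves\<close>

definition submean :: "(complex^'n \<Rightarrow> real) \<Rightarrow> bool" where
  "submean f \<longleftrightarrow> (\<forall>a b. f a \<le> (\<integral>\<theta>. f (a + cis \<theta> *s b) \<partial>circ))"

text \<open>Nonnegativity together with the local upper bound from semicontinuity makes every circle
  integrand integrable, so the Bochner integral in \<open>submean\<close> never takes its default
  value \<open>0\<close>.\<close>

definition nonneg_psh :: "(complex^'n \<Rightarrow> real) \<Rightarrow> bool" where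
  "nonneg_psh f \<longleftrightarrow> (\<forall>z. 0 \<le> f z) \<and> usc f \<and> submean f"

lemma continuous_on_vector_smult [continuous_intros]:
  fixes c :: "'a::topological_space \<Rightarrow> complex" and x :: "'a \<Rightarrow> complex^'n"
  assumes "continuous_on A c" "continuous_on A x"
  shows "continuous_on A (\<lambda>t. c t *s x t)"
  unfolding vector_scalar_mult_def
  by (intro continuous_intros continuous_on_vec_lambda assms)

lemma norm_vector_smult: "norm (c *s (x::complex^'n)) = cmod c * norm x"
  by (simp add: norm_vec_def norm_mult L2_set_right_distrib)

lemma circle_in_cball: "a + cis \<theta> *s (b::complex^'n) \<in> cball 0 (norm a + norm b)"
  using norm_triangle_ineq[of a "cis \<theta> *s b"] by (simp add: norm_vector_smult)

lemma usc_circle_bounded: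
  fixes f :: "complex^'n \<Rightarrow> real"
  assumes "usc f"
  obtains M where "\<And>\<theta>. f (a + cis \<theta> *s b) \<le> M"
  using usc_bounded_on_compact[OF assms compact_cball[of 0 "norm a + norm b"]] circle_in_cball by blast

lemma usc_circle_measurable:
  fixes f :: "complex^'n \<Rightarrow> real"
  assumes "usc f"
  shows "(\<lambda>\<theta>. f (a + cis \<theta> *s b)) \<in> borel_measurable borel"
  by (rule usc_borel_measurable[OF usc_compose[OF assms]]) (intro continuous_intros)

lemma usc_circle_integrable:
  fixes f :: "complex^'n \<Rightarrow> real"
  assumes "usc f" "\<And>z. 0 \<le> f z"
  shows "integrable circ (\<lambda>\<theta>. f (a + cis \<theta> *s b))"
proof -
  obtain M where "\<And>\<theta>. f (a + cis \<theta> *s b) \<le> M" using usc_circle_bounded[OF assms(1)] by blast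
  then show ?thesis
    using assms(2) by (intro integrable_circ_bounded[of _ M] usc_circle_measurable assms) auto
qed

lemma norm_vec_squared: "(norm (x::complex^'n))\<^sup>2 = (\<Sum>k\<in>UNIV. (cmod (x$k))\<^sup>2)"
  by (simp add: norm_vec_def L2_set_def sum_nonneg)

lemma cmod_diff_squared: "(cmod (d - x))\<^sup>2 = (cmod d)\<^sup>2 - 2 * Re (cnj d * x) + (cmod x)\<^sup>2"
  unfolding cmod_power2 by (simp add: power2_eq_square algebra_simps)

text \<open>When the square is expanded, the cross term is the real part of an entire function
  vanishing at \<open>0\<close>, hence has mean zero. The error is therefore quadratic in
  \<open>B\<close>; a linear error would not be of order \<open>o(r\<^sup>2)\<close> in the maximum
  principle.\<close>

lemma circ_mean_square_holomorphic:
  assumes R: "R holomorphic_on UNIV" "R 0 = 0" and r: "0 < r"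
    and bd: "\<And>\<eta>. cmod \<eta> = r \<Longrightarrow> cmod (R \<eta>) \<le> B"
  shows "(\<integral>\<theta>. (cmod (d - R (of_real r * cis \<theta>)))\<^sup>2 \<partial>circ) \<le> (cmod d)\<^sup>2 + B\<^sup>2"
    and "integrable circ (\<lambda>\<theta>. (cmod (d - R (of_real r * cis \<theta>)))\<^sup>2)"
proof -
  let ?S = "\<lambda>\<theta>. R (of_real r * cis \<theta>)"
  have contR: "continuous_on UNIV R" using R(1) by (rule holomorphic_on_imp_continuous_on)
  have "continuous_on UNIV ?S"
    by (rule continuous_on_compose2[OF contR]) (auto intro!: continuous_intros)
  then have [measurable]: "?S \<in> borel_measurable borel" by (rule borel_measurable_continuous_onI)
  have bd': "cmod (?S \<theta>) \<le> B" for \<theta> using bd[of "of_real r * cis \<theta>"] r by (simp add: norm_mult)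
  have B: "B \<ge> 0" using bd'[of 0] norm_ge_zero order_trans by blast
  have "norm (Re (cnj d * ?S \<theta>)) \<le> cmod d * B" for \<theta>
    using abs_Re_le_cmod[of "cnj d * ?S \<theta>"] mult_left_mono[OF bd', of "cmod d" \<theta>]
    by (simp add: norm_mult)
  then have i1: "integrable circ (\<lambda>\<theta>. Re (cnj d * ?S \<theta>))"
    by (intro integrable_circ_bounded[of _ "cmod d * B"]) auto
  have i2: "integrable circ (\<lambda>\<theta>. (cmod (?S \<theta>))\<^sup>2)"
    by (rule integrable_circ_bounded[of _ "B\<^sup>2"], measurable) (use bd' in \<open>auto intro!: power_mono\<close>)
  have i3: "integrable circ ?S"
    by (rule integrable_circ_bounded[of _ B]) (use bd' in auto)
  have "(\<integral>\<theta>. Re (cnj d * ?S \<theta>) \<partial>circ) = Re (\<integral>\<theta>. cnj d * ?S \<theta> \<partial>circ)"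
    using i3 by (intro integral_Re) auto
  also have "\<dots> = 0"
    using holomorphic_circ_mean[OF R(1) r, of 0] R(2) by simp
  finally have z: "(\<integral>\<theta>. Re (cnj d * ?S \<theta>) \<partial>circ) = 0" .
  have "has_bochner_integral circ (\<lambda>\<theta>. (cmod d)\<^sup>2 - 2 * Re (cnj d * ?S \<theta>) + (cmod (?S \<theta>))\<^sup>2)
      ((cmod d)\<^sup>2 - 2 * 0 + (\<integral>\<theta>. (cmod (?S \<theta>))\<^sup>2 \<partial>circ))"
    using i1 i2 z
    by (intro has_bochner_integral_add has_bochner_integral_diff has_bochner_integral_mult_right
        has_bochner_integral_circ_const) (simp_all only: has_bochner_integral_iff simp_thms)
  then have *: "has_bochner_integral circ (\<lambda>\<theta>. (cmod (d - ?S \<theta>))\<^sup>2)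
      ((cmod d)\<^sup>2 + (\<integral>\<theta>. (cmod (?S \<theta>))\<^sup>2 \<partial>circ))"
    by (simp only: cmod_diff_squared mult_zero_right diff_zero)
  then show "integrable circ (\<lambda>\<theta>. (cmod (d - ?S \<theta>))\<^sup>2)"
    by (rule integrable.intros)
  have "(\<integral>\<theta>. (cmod (d - ?S \<theta>))\<^sup>2 \<partial>circ) = (cmod d)\<^sup>2 + (\<integral>\<theta>. (cmod (?S \<theta>))\<^sup>2 \<partial>circ)"
    using * by (rule has_bochner_integral_integral_eq)
  also have "(\<integral>\<theta>. (cmod (?S \<theta>))\<^sup>2 \<partial>circ) \<le> (\<integral>\<theta>. B\<^sup>2 \<partial>circ)"
    using i2 bd' by (intro integral_mono) (auto intro!: power_mono)
  finally show "(\<integral>\<theta>. (cmod (d - ?S \<theta>))\<^sup>2 \<partial>circ) \<le> (cmod d)\<^sup>2 + B\<^sup>2" by simp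
qed

text \<open>The surplus \<open>r\<^sup>2\<close> is the strict gain that the maximum principle plays
  against the growth of its penalty.\<close>

lemma circ_mean_shifted_square:
  assumes "0 < r"
  shows "(\<integral>\<theta>. (cmod (\<zeta> + of_real r * cis \<theta>))\<^sup>2 \<partial>circ) = (cmod \<zeta>)\<^sup>2 + r\<^sup>2"
    and "integrable circ (\<lambda>\<theta>. (cmod (\<zeta> + of_real r * cis \<theta>))\<^sup>2)"
proof -
  have *: "(cmod (\<zeta> + of_real r * cis \<theta>))\<^sup>2 = ((cmod \<zeta>)\<^sup>2 + r\<^sup>2) + 2 * Re (cnj \<zeta> * (of_real r * cis \<theta>))" for \<theta>
    using cmod_diff_squared[of \<zeta> "- (of_real r * cis \<theta>)"] assms by (simp add: norm_mult)
  have i: "integrable circ (\<lambda>\<theta>. cnj \<zeta> * (of_real r * cis \<theta>))"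
    by (rule integrable_circ_bounded[of _ "cmod \<zeta> * r"])
       (use assms in \<open>auto simp: norm_mult intro!: borel_measurable_continuous_onI continuous_intros\<close>)
  have "(\<integral>\<theta>. cnj \<zeta> * (0 + of_real r * cis \<theta>) \<partial>circ) = cnj \<zeta> * 0"
    by (rule holomorphic_circ_mean) (auto intro!: holomorphic_intros assms)
  then have z: "(\<integral>\<theta>. Re (cnj \<zeta> * (of_real r * cis \<theta>)) \<partial>circ) = 0"
    by (simp only: integral_Re[OF i] add_0_left mult_zero_right zero_complex.sel)
  have "has_bochner_integral circ (\<lambda>\<theta>. ((cmod \<zeta>)\<^sup>2 + r\<^sup>2) + 2 * Re (cnj \<zeta> * (of_real r * cis \<theta>)))
      (((cmod \<zeta>)\<^sup>2 + r\<^sup>2) + 2 * 0)"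
    using integrable_Re[OF i] z
    by (intro has_bochner_integral_add has_bochner_integral_mult_right
        has_bochner_integral_circ_const) (simp_all only: has_bochner_integral_iff simp_thms)
  then have **: "has_bochner_integral circ (\<lambda>\<theta>. (cmod (\<zeta> + of_real r * cis \<theta>))\<^sup>2) ((cmod \<zeta>)\<^sup>2 + r\<^sup>2)"
    by (simp only: * mult_zero_right add_0_right)
  then show "(\<integral>\<theta>. (cmod (\<zeta> + of_real r * cis \<theta>))\<^sup>2 \<partial>circ) = (cmod \<zeta>)\<^sup>2 + r\<^sup>2"
    and "integrable circ (\<lambda>\<theta>. (cmod (\<zeta> + of_real r * cis \<theta>))\<^sup>2)"
    by (auto simp only: has_bochner_integral_iff)
qed

text \<open>Doubling of variables: a penalised maximum point of \<open>f z + \<epsilon> |\<zeta>|\<^sup>2 - N |z - F \<zeta>|\<^sup>2\<close> is tested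
  along the line with direction \<open>F' \<zeta>\<close>, where the penalty grows on average by only \<open>o(r\<^sup>2)\<close>
  because holomorphic remainders have mean zero. No regularity beyond upper semicontinuity is used.\<close>

lemma psh_maximum_principle_curve:
  fixes f :: "complex^'n \<Rightarrow> real" and F :: "complex \<Rightarrow> complex^'n"
  assumes f: "nonneg_psh f" and F: "\<And>k. (\<lambda>\<zeta>. F \<zeta> $ k) holomorphic_on UNIV"
    and bd: "\<And>\<zeta>. cmod \<zeta> = 1 \<Longrightarrow> f (F \<zeta>) \<le> c"
  shows "f (F 0) \<le> c"
proof (rule ccontr)
  assume neg: "\<not> f (F 0) \<le> c"
  \<comment> \<open>Half the gap: the penalised function is \<open>c + 2 * \<epsilon>\<close> at
    \<open>(F 0, 0)\<close>, while over the unit circle the values of \<open>f\<close> near the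
    curve stay below \<open>c + \<epsilon>\<close> and the quadratic term adds only
    \<open>\<epsilon>\<close>. The maximum thus cannot sit over the circle.\<close>
  define \<epsilon> where "\<epsilon> = (f (F 0) - c) / 2"
  have \<epsilon>: "\<epsilon> > 0" "f (F 0) = c + 2 * \<epsilon>" using neg by (auto simp: \<epsilon>_def field_simps)
  have nn: "\<And>z. 0 \<le> f z" and us: "usc f" and sm: "\<And>a b. f a \<le> (\<integral>\<theta>. f (a + cis \<theta> *s b) \<partial>circ)"
    using f by (auto simp: nonneg_psh_def submean_def)
  have contF: "continuous_on A F" for A
  proof -
    have "continuous_on A (\<lambda>\<zeta>. \<chi> k. F \<zeta> $ k)"
      by (intro continuous_on_vec_lambda continuous_on_subset[OF holomorphic_on_imp_continuous_on[OF F]]) auto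
    then show ?thesis by simp
  qed
  have "compact (F ` cball 0 1)" "compact (F ` sphere 0 1)"
    by (auto intro!: compact_continuous_image contF)
  have "bounded (F ` cball 0 1)" using \<open>compact (F ` cball 0 1)\<close> by (rule compact_imp_bounded)
  then obtain \<rho>0 where \<rho>0: "\<And>\<zeta>. cmod \<zeta> \<le> 1 \<Longrightarrow> norm (F \<zeta>) \<le> \<rho>0"
    unfolding bounded_iff by (metis dist_0_norm imageI mem_cball)
  \<comment> \<open>The margin \<open>1\<close> exceeds or equals the later distance
    \<open>e\<close>, so a point within \<open>e\<close> of the curve is interior to the ball of
    radius \<open>\<rho>\<close>.\<close>
  define \<rho> where "\<rho> = \<rho>0 + 1"
  have "\<exists>e>0. (\<Union>x\<in>F ` sphere 0 1. ball x e) \<subseteq> {z. f z < c + \<epsilon>}"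
  proof (rule compact_subset_open_imp_ball_epsilon_subset[OF \<open>compact (F ` sphere 0 1)\<close> open_usc[OF us, of "c+\<epsilon>"]])
    show "F ` sphere 0 1 \<subseteq> {z. f z < c + \<epsilon>}" using bd \<epsilon>(1) by force
  qed blast
  then obtain e0 where e0: "e0 > 0" "\<And>\<zeta> z. cmod \<zeta> = 1 \<Longrightarrow> dist (F \<zeta>) z < e0 \<Longrightarrow> f z < c + \<epsilon>"
    by (force simp: subset_iff)
  define e where "e = min e0 1"
  have e: "e > 0" "e \<le> 1" "e \<le> e0" using e0(1) by (auto simp: e_def)
  obtain A where A: "\<And>z. norm z \<le> \<rho> \<Longrightarrow> f z \<le> A"
    using usc_bounded_on_compact[OF us compact_cball[of 0 \<rho>]] by (metis dist_0_norm mem_cball)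
  \<comment> \<open>The penalty at distance \<open>e\<close> must outweigh the largest conceivable
    advantage \<open>A + \<epsilon>\<close> over the value \<open>c + 2 * \<epsilon>\<close>; this
    forces the maximum point to lie within \<open>e\<close> of the curve.\<close>
  obtain N where N: "N > 0" "N * e\<^sup>2 > A + \<epsilon> - c - 2*\<epsilon>"
  proof
    show "max 1 ((\<bar>A + \<epsilon> - c - 2*\<epsilon>\<bar> + 1) / e\<^sup>2) > 0" by simp
    have "A + \<epsilon> - c - 2*\<epsilon> < (\<bar>A + \<epsilon> - c - 2*\<epsilon>\<bar> + 1) / e\<^sup>2 * e\<^sup>2" using e(1) by simp
    also have "\<dots> \<le> max 1 ((\<bar>A + \<epsilon> - c - 2*\<epsilon>\<bar> + 1) / e\<^sup>2) * e\<^sup>2" by (intro mult_right_mono) auto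
    finally show "max 1 ((\<bar>A + \<epsilon> - c - 2*\<epsilon>\<bar> + 1) / e\<^sup>2) * e\<^sup>2 > A + \<epsilon> - c - 2*\<epsilon>" .
  qed
  define \<psi> where "\<psi> = (\<lambda>p. f (fst p) + (\<epsilon> * (cmod (snd p))\<^sup>2 - N * (norm (fst p - F (snd p)))\<^sup>2))"
  let ?K = "cball (0::complex^'n) \<rho> \<times> cball (0::complex) 1"
  have "usc \<psi>" unfolding \<psi>_def
    by (intro usc_add_continuous usc_compose[OF us] continuous_intros continuous_on_compose2[OF contF[of UNIV]]) auto
  moreover have F0: "(F 0, 0) \<in> ?K" using \<rho>0[of 0] by (auto simp: \<rho>_def)
  moreover have "compact ?K" by (intro compact_Times compact_cball)
  ultimately obtain p where p: "p \<in> ?K" "\<And>q. q \<in> ?K \<Longrightarrow> \<psi> q \<le> \<psi> p"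
    using usc_attains_sup[of \<psi> ?K] by blast
  obtain z0 \<zeta>0 where zz: "p = (z0, \<zeta>0)" by (cases p)
  have in0: "norm z0 \<le> \<rho>" "cmod \<zeta>0 \<le> 1" using p(1) zz by auto
  have sq1: "(cmod \<zeta>0)\<^sup>2 \<le> 1" using in0(2) by (simp add: power_le_one)
  have big: "c + 2*\<epsilon> \<le> \<psi> (z0, \<zeta>0)" using p(2)[OF F0] by (simp add: zz \<psi>_def \<epsilon>(2))
  have "f z0 \<le> A" using A in0 by auto
  have "\<epsilon> * (cmod \<zeta>0)\<^sup>2 \<le> \<epsilon>" using \<epsilon>(1) sq1 by (simp add: mult_left_le)
  have "N * (norm (z0 - F \<zeta>0))\<^sup>2 \<le> A + \<epsilon> - c - 2*\<epsilon>"
    using big \<open>f z0 \<le> A\<close> \<open>\<epsilon> * _ \<le> \<epsilon>\<close> by (simp add: \<psi>_def)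
  also have "\<dots> < N * e\<^sup>2" by (rule N)
  finally have "(norm (z0 - F \<zeta>0))\<^sup>2 < e\<^sup>2" using N(1) by simp
  then have near: "norm (z0 - F \<zeta>0) < e" using e(1) by (simp add: power2_less_imp_less)
  have "cmod \<zeta>0 \<noteq> 1"
  proof
    assume 1: "cmod \<zeta>0 = 1"
    then have "f z0 < c + \<epsilon>" using e0(2)[OF 1, of z0] near e by (simp add: dist_norm norm_minus_commute)
    moreover have "0 \<le> N * (norm (z0 - F \<zeta>0))\<^sup>2" using N(1) by simp
    ultimately show False using big 1 by (simp add: \<psi>_def)
  qed
  then have int1: "cmod \<zeta>0 < 1" using in0 by auto
  have int2: "norm z0 < \<rho>"
    using near e \<rho>0[OF in0(2)] norm_triangle_ineq[of "z0 - F \<zeta>0" "F \<zeta>0"] by (simp add: \<rho>_def)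
  define w where "w = (\<chi> k. deriv (\<lambda>\<zeta>. F \<zeta> $ k) \<zeta>0)"
  define R where "R = (\<lambda>k \<eta>. F (\<zeta>0 + \<eta>) $ k - F \<zeta>0 $ k - \<eta> * w $ k)"
  \<comment> \<open>Each of the \<open>CARD('n)\<close> coordinates will contribute at most
    \<open>(\<kappa> * r)\<^sup>2\<close> to the mean of the squared distance, so the penalty grows
    by less than the gain \<open>\<epsilon> * r\<^sup>2\<close>. The choice of
    \<open>\<kappa>\<close> may depend on \<open>N\<close>, which is already fixed.\<close>
  have "\<exists>\<kappa>>0. N * real CARD('n) * \<kappa>\<^sup>2 < \<epsilon>"
  proof (intro exI conjI)
    let ?k = "sqrt (\<epsilon> / (2 * N * real CARD('n)))"
    show "?k > 0" using \<epsilon>(1) N(1) by simp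
    have "?k\<^sup>2 = \<epsilon> / (2 * N * real CARD('n))" using \<epsilon>(1) N(1) by simp
    then show "N * real CARD('n) * ?k\<^sup>2 < \<epsilon>" using \<epsilon>(1) N(1) by (simp add: field_simps)
  qed
  then obtain \<kappa> where \<kappa>: "\<kappa> > 0" "N * real CARD('n) * \<kappa>\<^sup>2 < \<epsilon>" by blast
  have small: "\<forall>\<^sub>F \<eta> in at 0. \<forall>k. cmod (R k \<eta>) \<le> \<kappa> * cmod \<eta>"
  proof (rule eventually_all_finite)
    fix k
    have "((\<lambda>\<zeta>. F \<zeta> $ k) has_field_derivative w $ k) (at \<zeta>0)"
      unfolding w_def using F[of k] by (simp add: holomorphic_derivI)
    then have "((\<lambda>h. (F (\<zeta>0 + h) $ k - F \<zeta>0 $ k) / h) \<longlongrightarrow> w $ k) (at 0)"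
      by (simp add: DERIV_def)
    then have "\<forall>\<^sub>F h in at 0. dist ((F (\<zeta>0 + h) $ k - F \<zeta>0 $ k) / h) (w $ k) < \<kappa>"
      using \<kappa>(1) by (rule tendstoD)
    moreover have "\<forall>\<^sub>F h in at (0::complex). h \<noteq> 0" by (simp add: eventually_at_filter)
    ultimately show "\<forall>\<^sub>F \<eta> in at 0. cmod (R k \<eta>) \<le> \<kappa> * cmod \<eta>"
    proof eventually_elim
      case (elim h)
      have "R k h = h * ((F (\<zeta>0 + h) $ k - F \<zeta>0 $ k) / h - w $ k)"
        using elim(2) by (simp add: R_def field_simps)
      then show ?case using elim by (simp add: dist_norm norm_mult mult.commute)
    qed
  qed
  then obtain r0 where r0: "r0 > 0" "\<And>\<eta> k. \<eta> \<noteq> 0 \<Longrightarrow> cmod \<eta> < r0 \<Longrightarrow> cmod (R k \<eta>) \<le> \<kappa> * cmod \<eta>"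
    by (auto simp: eventually_at dist_norm)
  have "\<exists>r>0. r < r0 \<and> r < 1 - cmod \<zeta>0 \<and> r * norm w < \<rho> - norm z0"
  proof -
    have "((\<lambda>r. r * norm w) \<longlongrightarrow> 0 * norm w) (at_right 0)"
      by (intro tendsto_intros)
    then have "\<forall>\<^sub>F r in at_right 0. r * norm w < \<rho> - norm z0"
      by (rule order_tendstoD(2)) (simp add: int2)
    moreover have "\<forall>\<^sub>F r in at_right 0. r < r0" "\<forall>\<^sub>F r in at_right 0. r < 1 - cmod \<zeta>0"
      using r0(1) int1 by (auto intro!: order_tendstoD(2)[of _ 0] tendsto_intros)
    ultimately have "\<forall>\<^sub>F r in at_right 0. r > 0 \<and> r < r0 \<and> r < 1 - cmod \<zeta>0 \<and> r * norm w < \<rho> - norm z0"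
      using eventually_at_right_less[of "0::real"] by eventually_elim auto
    then show ?thesis by (auto dest: eventually_happens)
  qed
  then obtain r where r: "r > 0" "r < r0" "r < 1 - cmod \<zeta>0" "r * norm w < \<rho> - norm z0" by blast
  define d where "d = z0 - F \<zeta>0"
  let ?\<eta> = "\<lambda>\<theta>. of_real r * cis \<theta>"
  define G where "G = (\<lambda>\<theta>. f z0 - N * (norm d)\<^sup>2 + \<epsilon> * (cmod \<zeta>0)\<^sup>2
      + N * (\<Sum>k\<in>UNIV. (cmod (d$k - R k (?\<eta> \<theta>)))\<^sup>2) - \<epsilon> * (cmod (\<zeta>0 + ?\<eta> \<theta>))\<^sup>2)"
  have le: "f (z0 + cis \<theta> *s (of_real r *s w)) \<le> G \<theta>" for \<theta>
  proof -
    let ?z = "z0 + cis \<theta> *s (of_real r *s w)" and ?ze = "\<zeta>0 + ?\<eta> \<theta>"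
    have "norm ?z \<le> norm z0 + r * norm w"
      using norm_triangle_ineq[of z0 "cis \<theta> *s (of_real r *s w)"] r(1) by (simp add: norm_vector_smult norm_mult)
    moreover have "cmod ?ze \<le> cmod \<zeta>0 + r"
      using norm_triangle_ineq[of \<zeta>0 "?\<eta> \<theta>"] r(1) by (simp add: norm_mult)
    ultimately have "(?z, ?ze) \<in> ?K" using r by auto
    from p(2)[OF this] have *: "f ?z + (\<epsilon> * (cmod ?ze)\<^sup>2 - N * (norm (?z - F ?ze))\<^sup>2)
        \<le> f z0 + (\<epsilon> * (cmod \<zeta>0)\<^sup>2 - N * (norm d)\<^sup>2)"
      by (simp add: \<psi>_def zz d_def)
    \<comment> \<open>The first variable moves along the tangent and the second along the curve, so
      their first-order changes cancel and only the Taylor remainder is left.\<close>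
    have "(?z - F ?ze) $ k = d$k - R k (?\<eta> \<theta>)" for k
      by (simp add: d_def R_def algebra_simps)
    then have "(norm (?z - F ?ze))\<^sup>2 = (\<Sum>k\<in>UNIV. (cmod (d$k - R k (?\<eta> \<theta>)))\<^sup>2)"
      by (simp only: norm_vec_squared)
    with * show ?thesis by (simp add: G_def)
  qed
  have holR: "R k holomorphic_on UNIV" for k
    unfolding R_def
    by (intro holomorphic_intros holomorphic_on_compose_gen[OF _ F[of k], unfolded o_def]) auto
  have R0: "R k 0 = 0" for k by (simp add: R_def)
  have Rb: "cmod (R k \<eta>) \<le> \<kappa> * r" if "cmod \<eta> = r" for k \<eta>
    using r0(2)[of \<eta> k] that r by force
  note m = circ_mean_square_holomorphic[OF holR R0 r(1) Rb]
  note q = circ_mean_shifted_square[OF r(1)]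
  have "has_bochner_integral circ G (f z0 - N * (norm d)\<^sup>2 + \<epsilon> * (cmod \<zeta>0)\<^sup>2
      + N * (\<Sum>k\<in>UNIV. (\<integral>\<theta>. (cmod (d$k - R k (?\<eta> \<theta>)))\<^sup>2 \<partial>circ)) - \<epsilon> * ((cmod \<zeta>0)\<^sup>2 + r\<^sup>2))"
    unfolding G_def
    by (intro has_bochner_integral_add has_bochner_integral_diff has_bochner_integral_mult_right
        has_bochner_integral_circ_const has_bochner_integral_sum)
       (simp_all only: has_bochner_integral_iff simp_thms m q)
  then have intG: "integrable circ G" and "integral\<^sup>L circ G = f z0 - N * (norm d)\<^sup>2 + \<epsilon> * (cmod \<zeta>0)\<^sup>2
      + N * (\<Sum>k\<in>UNIV. (\<integral>\<theta>. (cmod (d$k - R k (?\<eta> \<theta>)))\<^sup>2 \<partial>circ)) - \<epsilon> * ((cmod \<zeta>0)\<^sup>2 + r\<^sup>2)"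
    by (auto simp only: has_bochner_integral_iff)
  have "f z0 \<le> (\<integral>\<theta>. f (z0 + cis \<theta> *s (of_real r *s w)) \<partial>circ)" by (rule sm)
  also have "\<dots> \<le> (\<integral>\<theta>. G \<theta> \<partial>circ)"
    by (intro integral_mono usc_circle_integrable us nn intG le)
  also have "\<dots> = f z0 - N * (norm d)\<^sup>2 + \<epsilon> * (cmod \<zeta>0)\<^sup>2
      + N * (\<Sum>k\<in>UNIV. (\<integral>\<theta>. (cmod (d$k - R k (?\<eta> \<theta>)))\<^sup>2 \<partial>circ)) - \<epsilon> * ((cmod \<zeta>0)\<^sup>2 + r\<^sup>2)"
    by fact
  also have "\<dots> \<le> f z0 - N * (norm d)\<^sup>2 + \<epsilon> * (cmod \<zeta>0)\<^sup>2
      + N * (\<Sum>k\<in>(UNIV::'n set). (cmod (d$k))\<^sup>2 + (\<kappa> * r)\<^sup>2) - \<epsilon> * ((cmod \<zeta>0)\<^sup>2 + r\<^sup>2)"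
    using N(1) m(1) by (intro diff_right_mono add_left_mono mult_left_mono sum_mono) auto
  also have "\<dots> = f z0 + (N * real CARD('n) * \<kappa>\<^sup>2 - \<epsilon>) * r\<^sup>2"
    by (simp add: sum.distrib norm_vec_squared power_mult_distrib algebra_simps)
  also have "\<dots> < f z0"
    using \<kappa>(2) r(1) by (simp add: mult_neg_pos)
  finally show False by simp
qed

section \<open>Logarithmic plurisubharmonicity\<close>

definition trig_real :: "(complex \<Rightarrow> real) \<Rightarrow> bool" where
  "trig_real g \<longleftrightarrow> (\<exists>p::complex poly. \<forall>\<zeta>. cmod \<zeta> = 1 \<longrightarrow> g \<zeta> = Re (poly p \<zeta>))"

lemma trig_real_add: "trig_real f \<Longrightarrow> trig_real g \<Longrightarrow> trig_real (\<lambda>\<zeta>. f \<zeta> + g \<zeta>)"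
  unfolding trig_real_def by (metis poly_add plus_complex.sel(1))

lemma trig_real_sum: "(\<And>i. i \<in> I \<Longrightarrow> trig_real (f i)) \<Longrightarrow> trig_real (\<lambda>\<zeta>. \<Sum>i\<in>I. f i \<zeta>)"
proof (induction I rule: infinite_finite_induct)
  case (insert x F)
  then show ?case by (simp add: trig_real_add)
qed (auto simp: trig_real_def intro!: exI[of _ 0])

text \<open>The product of real parts is half the real part of \<open>x * y\<close> plus half that
  of \<open>x * cnj y\<close>. On the unit circle conjugation inverts \<open>\<zeta>\<close>, and a
  negative exponent is removed by conjugating the whole term, which leaves its real part unchanged.
  Hence ordinary polynomials suffice to represent all trigonometric ones.\<close>

lemma trig_real_monom_mult: "trig_real (\<lambda>\<zeta>. Re (c * \<zeta> ^ n) * Re (d * \<zeta> ^ m))"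
proof -
  have prod: "Re x * Re y = Re (x * y / 2) + Re (x * cnj y / 2)" for x y
    by (simp add: field_simps)
  have unit: "\<zeta> ^ k * cnj \<zeta> ^ k = 1" if "cmod \<zeta> = 1" for \<zeta> k
    using that complex_norm_square[of \<zeta>] by (simp add: power_mult_distrib[symmetric])
  define e where "e = (if m \<le> n then monom (c * cnj d / 2) (n - m) else monom (cnj c * d / 2) (m - n))"
  have e: "Re (c * \<zeta>^n * cnj (d * \<zeta>^m) / 2) = Re (poly e \<zeta>)" if z: "cmod \<zeta> = 1" for \<zeta>
  proof (cases "m \<le> n")
    case True
    then have "\<zeta>^n = \<zeta>^(n - m) * \<zeta>^m" by (simp flip: power_add)
    then have "c * \<zeta>^n * cnj (d * \<zeta>^m) / 2 = c * cnj d / 2 * \<zeta>^(n - m) * (\<zeta>^m * cnj \<zeta>^m)"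
      by (simp add: algebra_simps)
    then have "poly e \<zeta> = c * \<zeta>^n * cnj (d * \<zeta>^m) / 2"
      using True by (simp only: unit[OF z] e_def if_True poly_monom mult_1_right)
    then show ?thesis by (simp only:)
  next
    case False
    then have "\<zeta>^m = \<zeta>^(m - n) * \<zeta>^n" by (simp flip: power_add)
    then have "cnj c * d / 2 * \<zeta>^(m - n) * (\<zeta>^n * cnj \<zeta>^n) = cnj (c * \<zeta>^n * cnj (d * \<zeta>^m) / 2)"
      by (simp add: algebra_simps)
    then have "poly e \<zeta> = cnj (c * \<zeta>^n * cnj (d * \<zeta>^m) / 2)"
      using False by (simp only: unit[OF z] e_def if_False poly_monom mult_1_right)
    then show ?thesis by (simp only: cnj.sel)
  qed
  have "Re (c * \<zeta>^n) * Re (d * \<zeta>^m) = Re (poly (monom (c * d / 2) (n + m) + e) \<zeta>)"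
    if "cmod \<zeta> = 1" for \<zeta>
  proof -
    have "c * \<zeta>^n * (d * \<zeta>^m) / 2 = poly (monom (c * d / 2) (n + m)) \<zeta>"
      by (simp add: poly_monom power_add field_simps)
    then show ?thesis unfolding prod e[OF that] by (simp only: poly_add plus_complex.sel)
  qed
  then show ?thesis unfolding trig_real_def by blast
qed

lemma trig_real_mult:
  assumes "trig_real f" "trig_real g"
  shows "trig_real (\<lambda>\<zeta>. f \<zeta> * g \<zeta>)"
proof -
  obtain p where p: "\<And>\<zeta>. cmod \<zeta> = 1 \<Longrightarrow> f \<zeta> = Re (poly p \<zeta>)"
    using assms(1) unfolding trig_real_def by blast
  obtain q where q: "\<And>\<zeta>. cmod \<zeta> = 1 \<Longrightarrow> g \<zeta> = Re (poly q \<zeta>)"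
    using assms(2) unfolding trig_real_def by blast
  have "trig_real (\<lambda>\<zeta>. \<Sum>i\<le>degree p. \<Sum>j\<le>degree q. Re (coeff p i * \<zeta>^i) * Re (coeff q j * \<zeta>^j))"
    by (intro trig_real_sum trig_real_monom_mult)
  moreover have "f \<zeta> * g \<zeta> = (\<Sum>i\<le>degree p. \<Sum>j\<le>degree q. Re (coeff p i * \<zeta>^i) * Re (coeff q j * \<zeta>^j))"
    if "cmod \<zeta> = 1" for \<zeta>
    unfolding p[OF that] q[OF that] poly_altdef Re_sum sum_product ..
  ultimately show ?thesis unfolding trig_real_def by (elim exE, intro exI) auto
qed

lemma trig_real_polynomial_function:
  assumes "real_polynomial_function g"
  shows "trig_real g"
  using assms
proof induction
  case (linear f)
  \<comment> \<open>Every real-linear functional on the complex plane is the real part of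
    multiplication by the number \<open>f 1 - \<i> * f \<i>\<close>.\<close>
  have "f \<zeta> = Re (poly [:0, of_real (f 1) - \<i> * of_real (f \<i>):] \<zeta>)" for \<zeta>
  proof -
    have "f (Re \<zeta> *\<^sub>R 1 + Im \<zeta> *\<^sub>R \<i>) = Re \<zeta> * f 1 + Im \<zeta> * f \<i>"
      using bounded_linear.linear[OF linear] by (simp only: linear_add linear_scale real_scaleR_def)
    moreover have "Re \<zeta> *\<^sub>R 1 + Im \<zeta> *\<^sub>R \<i> = \<zeta>" by (simp add: complex_eq_iff)
    ultimately show ?thesis by (simp add: algebra_simps)
  qed
  then show ?case unfolding trig_real_def by blast
next
  case (const c)
  show ?case unfolding trig_real_def by (rule exI[of _ "[:of_real c:]"]) simp
qed (auto intro: trig_real_add trig_real_mult)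

text \<open>A substitute for solving the Dirichlet problem: boundary data are met only
  approximately, but by the real part of a function holomorphic everywhere, which can be
  exponentiated and used as a time for the flow.\<close>

lemma Re_entire_approximation:
  assumes "continuous_on (sphere 0 1) \<phi>" "0 < e"
  shows "\<exists>P. P holomorphic_on UNIV \<and> (\<forall>\<zeta>. cmod \<zeta> = 1 \<longrightarrow> \<bar>\<phi> \<zeta> - Re (P \<zeta>)\<bar> < e)"
proof -
  obtain g where g: "real_polynomial_function g" "\<And>x. x \<in> sphere 0 1 \<Longrightarrow> \<bar>\<phi> x - g x\<bar> < e"
    using Stone_Weierstrass_real_polynomial_function[OF compact_sphere assms] by blast
  obtain p where "\<forall>\<zeta>. cmod \<zeta> = 1 \<longrightarrow> g \<zeta> = Re (poly p \<zeta>)"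
    using trig_real_polynomial_function[OF g(1)] unfolding trig_real_def by blast
  then show ?thesis
    using g(2) by (intro exI[of _ "poly p"]) (auto intro!: holomorphic_intros)
qed

text \<open>The majorants are the sup-convolutions of \<open>g\<close> with the cone
  \<open>real n * dist x w\<close>. They are \<open>n\<close>-Lipschitz, and as the cone steepens
  only values of \<open>g\<close> near \<open>x\<close> matter.\<close>

lemma usc_continuous_majorants:
  fixes g :: "'a::metric_space \<Rightarrow> real"
  assumes g: "usc g" and S: "S \<noteq> {}" and M: "\<And>x. x \<in> S \<Longrightarrow> g x \<le> M"
  obtains \<phi> :: "nat \<Rightarrow> 'a \<Rightarrow> real" where "\<And>n. continuous_on UNIV (\<phi> n)"
    "\<And>n x. x \<in> S \<Longrightarrow> g x \<le> \<phi> n x" "\<And>n x. \<phi> n x \<le> M"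
    "\<And>x. x \<in> S \<Longrightarrow> (\<lambda>n. \<phi> n x) \<longlonglongrightarrow> g x"
proof
  define \<phi> where "\<phi> = (\<lambda>n::nat. \<lambda>x. SUP w\<in>S. g w - real n * dist x w)"
  have le: "g w - real n * dist x w \<le> M" if "w \<in> S" for n x w
    using M[OF that] by (smt (verit) of_nat_0_le_iff mult_nonneg_nonneg zero_le_dist)
  have bdd: "bdd_above ((\<lambda>w. g w - real n * dist x w) ` S)" for n x
    using le by (auto intro!: bdd_aboveI)
  show "\<phi> n x \<le> M" for n x unfolding \<phi>_def using S le by (intro cSUP_least) auto
  show ge: "g x \<le> \<phi> n x" if "x \<in> S" for n x
    unfolding \<phi>_def using cSUP_upper[OF that bdd, of n x] by simp
  have lip: "\<phi> n x \<le> \<phi> n y + real n * dist x y" for n x y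
    unfolding \<phi>_def
  proof (rule cSUP_least[OF S])
    fix w assume w: "w \<in> S"
    have "real n * dist y w \<le> real n * (dist x y + dist x w)"
      by (intro mult_left_mono) (auto simp: dist_triangle3)
    then have "g w - real n * dist x w \<le> g w - real n * dist y w + real n * dist x y"
      by (simp add: algebra_simps)
    also have "\<dots> \<le> (SUP w\<in>S. g w - real n * dist y w) + real n * dist x y"
      using cSUP_upper[OF w bdd] by simp
    finally show "g w - real n * dist x w \<le> (SUP w\<in>S. g w - real n * dist y w) + real n * dist x y" .
  qed
  show "continuous_on UNIV (\<phi> n)" for n
  proof -
    have "\<bar>\<phi> n x - \<phi> n y\<bar> \<le> real n * dist x y" for x y
      using lip[of n x y] lip[of n y x] by (simp add: abs_le_iff dist_commute)
    then have "(real n)-lipschitz_on UNIV (\<phi> n)"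
      by (intro lipschitz_onI) (auto simp: dist_real_def)
    then show ?thesis by (rule lipschitz_on_continuous_on)
  qed
  show "(\<lambda>n. \<phi> n x) \<longlonglongrightarrow> g x" if x: "x \<in> S" for x
  proof (rule order_tendstoI)
    show "\<forall>\<^sub>F n in sequentially. c < \<phi> n x" if "c < g x" for c
      using less_le_trans[OF that ge[OF x]] by simp
    show "\<forall>\<^sub>F n in sequentially. \<phi> n x < c" if c: "g x < c" for c
    proof -
      obtain c' where c': "g x < c'" "c' < c" using dense[OF c] by blast
      obtain \<delta> where \<delta>: "\<delta> > 0" "\<And>w. dist w x < \<delta> \<Longrightarrow> g w < c'"
        using uscD[OF g c'(1)] by (auto simp: eventually_nhds_metric)
      \<comment> \<open>With this slope, points at distance at least \<open>\<delta>\<close>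
        contribute at most \<open>c'\<close> because \<open>g\<close> is bounded by \<open>M\<close>
        on \<open>S\<close>; nearer points have \<open>g w < c'\<close> anyway.\<close>
      obtain N :: nat where N: "M - c' < real N * \<delta>"
        using reals_Archimedean3[OF \<delta>(1)] by blast
      have "\<phi> n x \<le> c'" if n: "n \<ge> N" for n
        unfolding \<phi>_def
      proof (rule cSUP_least[OF S])
        fix w assume w: "w \<in> S"
        show "g w - real n * dist x w \<le> c'"
        proof (cases "dist w x < \<delta>")
          case True
          moreover have "0 \<le> real n * dist x w" by simp
          ultimately show ?thesis using \<delta>(2)[of w] by linarith
        next
          case False
          then have "real N * \<delta> \<le> real n * dist x w"
            using n \<delta>(1) by (intro mult_mono) (auto simp: dist_commute)
          then show ?thesis using M[OF w] N by linarith
        qed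
      qed
      then show ?thesis
        using c'(2) le_less_trans unfolding eventually_sequentially by blast
    qed
  qed
qed

lemma usc_circle_exp_majorants:
  assumes g: "usc g" and nn: "\<And>x. 0 \<le> g x" and B: "\<And>\<zeta>. cmod \<zeta> = 1 \<Longrightarrow> g \<zeta> < B"
  obtains P :: "nat \<Rightarrow> complex \<Rightarrow> complex" where "\<And>n. P n holomorphic_on UNIV"
    "\<And>n \<zeta>. cmod \<zeta> = 1 \<Longrightarrow> g \<zeta> \<le> exp (Re (P n \<zeta>))" "\<And>n \<zeta>. cmod \<zeta> = 1 \<Longrightarrow> exp (Re (P n \<zeta>)) \<le> B"
    "\<And>\<zeta>. cmod \<zeta> = 1 \<Longrightarrow> (\<lambda>n. exp (Re (P n \<zeta>))) \<longlonglongrightarrow> g \<zeta>"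
proof -
  let ?S = "sphere (0::complex) 1"
  have S: "?S \<noteq> {}" by (auto intro!: exI[of _ 1])
  obtain x0 where x0: "x0 \<in> ?S" "\<forall>w\<in>?S. g w \<le> g x0"
    using usc_attains_sup[OF g compact_sphere S] by blast
  define M where "M = g x0"
  have M: "M < B" "M \<ge> 0" using x0 B nn by (auto simp: M_def)
  obtain \<phi> where \<phi>: "\<And>n. continuous_on UNIV (\<phi> n)"
    "\<And>n x. x \<in> ?S \<Longrightarrow> g x \<le> \<phi> n x" "\<And>n x. \<phi> n x \<le> M"
    "\<And>x. x \<in> ?S \<Longrightarrow> (\<lambda>n. \<phi> n x) \<longlonglongrightarrow> g x"
    using usc_continuous_majorants[OF g S, of M] x0(2) unfolding M_def by blast
  define e where "e = (\<lambda>n::nat. 1 / real (Suc n))"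
  have e: "e n > 0" for n by (simp add: e_def)
  have e0: "e \<longlonglongrightarrow> 0" unfolding e_def by (rule lim_1_over_n[THEN LIMSEQ_Suc])
  have pos: "\<phi> n \<zeta> + e n > 0" if "cmod \<zeta> = 1" for n \<zeta>
    using \<phi>(2)[of \<zeta> n] nn[of \<zeta>] e[of n] that by simp
  \<comment> \<open>The shift \<open>e n\<close> inside the logarithm keeps its argument positive at
    zeros of \<open>g\<close>. The second \<open>e n\<close> raises the target, so that an
    approximation with error below \<open>e n\<close> still lies above
    \<open>ln (\<phi> n \<zeta> + e n)\<close>.\<close>
  have "\<exists>P. P holomorphic_on UNIV \<and> (\<forall>\<zeta>. cmod \<zeta> = 1 \<longrightarrow> \<bar>ln (\<phi> n \<zeta> + e n) + e n - Re (P \<zeta>)\<bar> < e n)" for n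
    using pos e by (intro Re_entire_approximation continuous_intros continuous_on_subset[OF \<phi>(1)]) (auto simp: less_le)
  then obtain P where P: "\<And>n. P n holomorphic_on UNIV"
    "\<And>n \<zeta>. cmod \<zeta> = 1 \<Longrightarrow> \<bar>ln (\<phi> n \<zeta> + e n) + e n - Re (P n \<zeta>)\<bar> < e n" by metis
  have lo: "\<phi> n \<zeta> + e n \<le> exp (Re (P n \<zeta>))" if z: "cmod \<zeta> = 1" for n \<zeta>
  proof -
    have "exp (ln (\<phi> n \<zeta> + e n)) \<le> exp (Re (P n \<zeta>))" using P(2)[OF z, of n] by simp
    then show ?thesis using pos[OF z] by simp
  qed
  have hi: "exp (Re (P n \<zeta>)) \<le> (\<phi> n \<zeta> + e n) * exp (2 * e n)" if z: "cmod \<zeta> = 1" for n \<zeta>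
  proof -
    have "exp (Re (P n \<zeta>)) \<le> exp (ln (\<phi> n \<zeta> + e n) + 2 * e n)" using P(2)[OF z, of n] by simp
    then show ?thesis using pos[OF z] by (simp add: exp_add)
  qed
  have lim: "(\<lambda>n. exp (Re (P n \<zeta>))) \<longlonglongrightarrow> g \<zeta>" if z: "cmod \<zeta> = 1" for \<zeta>
  proof (rule tendsto_sandwich[of "\<lambda>n. \<phi> n \<zeta> + e n" _ _ "\<lambda>n. (\<phi> n \<zeta> + e n) * exp (2 * e n)"])
    show "(\<lambda>n. (\<phi> n \<zeta> + e n) * exp (2 * e n)) \<longlonglongrightarrow> g \<zeta>"
      using z by (auto intro!: tendsto_eq_intros \<phi>(4) e0)
    show "(\<lambda>n. \<phi> n \<zeta> + e n) \<longlonglongrightarrow> g \<zeta>"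
      using z by (auto intro!: tendsto_eq_intros \<phi>(4) e0)
  qed (use lo hi z in auto)
  \<comment> \<open>The shifts overshoot the maximum \<open>M\<close>; since \<open>M < B\<close>
    strictly, the bound \<open>B\<close> holds after an initial segment is dropped.\<close>
  have "(\<lambda>n. (M + e n) * exp (2 * e n)) \<longlonglongrightarrow> M"
    by (auto intro!: tendsto_eq_intros e0)
  then have "\<forall>\<^sub>F n in sequentially. (M + e n) * exp (2 * e n) < B"
    using M(1) by (rule order_tendstoD)
  then obtain N where N: "\<And>n. n \<ge> N \<Longrightarrow> (M + e n) * exp (2 * e n) < B"
    by (auto simp: eventually_sequentially)
  show ?thesis
  proof (rule that[of "\<lambda>n. P (n + N)"])
    show "exp (Re (P (n + N) \<zeta>)) \<le> B" if z: "cmod \<zeta> = 1" for n \<zeta>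
    proof -
      have "(\<phi> (n+N) \<zeta> + e (n+N)) * exp (2 * e (n+N)) \<le> (M + e (n+N)) * exp (2 * e (n+N))"
        using \<phi>(3) by (intro mult_right_mono) auto
      then show ?thesis using N[of "n+N"] hi[OF z, of "n+N"] by linarith
    qed
    show "g \<zeta> \<le> exp (Re (P (n + N) \<zeta>))" if z: "cmod \<zeta> = 1" for n \<zeta>
      using lo[OF z, of "n+N"] \<phi>(2)[of \<zeta> "n+N"] e[of "n+N"] z by simp
    show "(\<lambda>n. exp (Re (P (n + N) \<zeta>))) \<longlonglongrightarrow> g \<zeta>" if "cmod \<zeta> = 1" for \<zeta>
      using lim[OF that] by (rule LIMSEQ_ignore_initial_segment)
  qed (use P in auto)
qed

section \<open>Homogeneous functions and exponential majorants\<close>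

definition homog :: "real^'n \<Rightarrow> (complex^'n \<Rightarrow> real) \<Rightarrow> bool" where
  "homog lam f \<longleftrightarrow> (\<forall>z t. f (Phi lam z t) = exp (- Re t) * f z)"

lemma homogD: "homog lam f \<Longrightarrow> f (Phi lam z t) = exp (- Re t) * f z"
  by (simp add: homog_def)

text \<open>Homogeneity turns \<open>exp (- Re P) f\<close> along a line into \<open>f\<close> along an entire curve; this is why
  members of \<open>H_lam\<close> are logarithmically plurisubharmonic.\<close>

lemma homog_psh_exp_majorant:
  fixes f :: "complex^'n \<Rightarrow> real"
  assumes f: "nonneg_psh f" "homog lam f" and P: "P holomorphic_on UNIV"
    and le: "\<And>\<zeta>. cmod \<zeta> = 1 \<Longrightarrow> f (a + \<zeta> *s b) \<le> exp (Re (P \<zeta>))"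
  shows "f a \<le> exp (Re (P 0))"
proof -
  let ?F = "\<lambda>\<zeta>. Phi lam (a + \<zeta> *s b) (P \<zeta>)"
  have "f (?F 0) \<le> 1"
  proof (rule psh_maximum_principle_curve[OF f(1)])
    show "(\<lambda>\<zeta>. ?F \<zeta> $ k) holomorphic_on UNIV" for k
      unfolding Phi_def by (auto intro!: holomorphic_intros P)
    show "f (?F \<zeta>) \<le> 1" if "cmod \<zeta> = 1" for \<zeta>
      using le[OF that] by (simp add: homogD[OF f(2)] exp_minus field_simps)
  qed
  then show ?thesis by (simp add: homogD[OF f(2)] exp_minus field_simps)
qed

text \<open>The working form of logarithmic plurisubharmonicity. The exponentials are bounded
  uniformly and converge to \<open>f\<close> on the circle, while each controls \<open>f\<close> at
  the centre; limit theorems then give the mean inequalities for powers, products and logarithms,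
  zeros of \<open>f\<close> included.\<close>

lemma homog_psh_exp_majorants:
  fixes f :: "complex^'n \<Rightarrow> real"
  assumes f: "nonneg_psh f" "homog lam f" and B: "\<And>\<theta>. f (a + cis \<theta> *s b) < B"
  obtains P :: "nat \<Rightarrow> complex \<Rightarrow> complex" where "\<And>n. P n holomorphic_on UNIV"
    "\<And>n \<theta>. exp (Re (P n (cis \<theta>))) \<le> B"
    "\<And>\<theta>. (\<lambda>n. exp (Re (P n (cis \<theta>)))) \<longlonglongrightarrow> f (a + cis \<theta> *s b)"
    "\<And>n. f a \<le> exp (Re (P n 0))"
proof -
  have us: "usc (\<lambda>\<zeta>. f (a + \<zeta> *s b))"
    using f(1) by (intro usc_compose[of f "\<lambda>\<zeta>. a + \<zeta> *s b"])
      (auto simp: nonneg_psh_def intro!: continuous_intros)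
  have nn: "0 \<le> f z" for z using f(1) by (simp add: nonneg_psh_def)
  have lt: "f (a + \<zeta> *s b) < B" if "cmod \<zeta> = 1" for \<zeta>
  proof -
    have "cis (Arg \<zeta>) = \<zeta>" using that by (subst cis_Arg) (auto simp: sgn_div_norm)
    then show ?thesis using B[of "Arg \<zeta>"] by simp
  qed
  show ?thesis
  proof (rule usc_circle_exp_majorants[OF us nn lt])
    fix P :: "nat \<Rightarrow> complex \<Rightarrow> complex"
    assume P: "\<And>n. P n holomorphic_on UNIV"
      "\<And>n \<zeta>. cmod \<zeta> = 1 \<Longrightarrow> f (a + \<zeta> *s b) \<le> exp (Re (P n \<zeta>))"
      "\<And>n \<zeta>. cmod \<zeta> = 1 \<Longrightarrow> exp (Re (P n \<zeta>)) \<le> B"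
      "\<And>\<zeta>. cmod \<zeta> = 1 \<Longrightarrow> (\<lambda>n. exp (Re (P n \<zeta>))) \<longlonglongrightarrow> f (a + \<zeta> *s b)"
    show thesis
      by (rule that[of P, OF P(1) P(3) P(4) homog_psh_exp_majorant[OF f P(1) P(2)]]) auto
  qed
qed

section \<open>Geometric means and mass estimates\<close>

lemma nonneg_pshD:
  assumes "nonneg_psh f"
  shows "0 \<le> f z" "usc f" "f a \<le> (\<integral>\<theta>. f (a + cis \<theta> *s b) \<partial>circ)"
  using assms by (auto simp: nonneg_psh_def submean_def)

text \<open>With each \<open>f j\<close> replaced by its majorant, the weighted product becomes the
  modulus of the single entire function \<open>exp (Q n)\<close>, to which the mean value property
  applies. Dominated convergence returns to the \<open>f j\<close>.\<close>

lemma psh_product_submean: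
  fixes f :: "'i \<Rightarrow> complex^'n \<Rightarrow> real"
  assumes J: "finite J" and f: "\<And>j. j \<in> J \<Longrightarrow> nonneg_psh (f j)" "\<And>j. j \<in> J \<Longrightarrow> homog lam (f j)"
    and \<alpha>: "\<And>j. j \<in> J \<Longrightarrow> 0 < \<alpha> j"
  shows "(\<Prod>j\<in>J. f j a powr \<alpha> j) \<le> (\<integral>\<theta>. (\<Prod>j\<in>J. f j (a + cis \<theta> *s b) powr \<alpha> j) \<partial>circ)"
proof -
  have "\<forall>j\<in>J. \<exists>B. \<forall>\<theta>. f j (a + cis \<theta> *s b) < B"
  proof
    fix j assume "j \<in> J"
    then obtain M where "\<And>\<theta>. f j (a + cis \<theta> *s b) \<le> M"
      using usc_circle_bounded[OF nonneg_pshD(2)[OF f(1)]] by blast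
    then have "\<forall>\<theta>. f j (a + cis \<theta> *s b) < M + 1" by (meson less_add_one le_less_trans)
    then show "\<exists>B. \<forall>\<theta>. f j (a + cis \<theta> *s b) < B" ..
  qed
  then obtain B where B: "\<And>j \<theta>. j \<in> J \<Longrightarrow> f j (a + cis \<theta> *s b) < B j" by metis
  have "\<forall>j\<in>J. \<exists>P::nat \<Rightarrow> complex \<Rightarrow> complex. (\<forall>n. P n holomorphic_on UNIV) \<and> (\<forall>n \<theta>. exp (Re (P n (cis \<theta>))) \<le> B j)
     \<and> (\<forall>\<theta>. (\<lambda>n. exp (Re (P n (cis \<theta>)))) \<longlonglongrightarrow> f j (a + cis \<theta> *s b)) \<and> (\<forall>n. f j a \<le> exp (Re (P n 0)))"
  proof
    fix j assume j: "j \<in> J"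
    show "\<exists>P::nat \<Rightarrow> complex \<Rightarrow> complex. (\<forall>n. P n holomorphic_on UNIV) \<and> (\<forall>n \<theta>. exp (Re (P n (cis \<theta>))) \<le> B j)
     \<and> (\<forall>\<theta>. (\<lambda>n. exp (Re (P n (cis \<theta>)))) \<longlonglongrightarrow> f j (a + cis \<theta> *s b)) \<and> (\<forall>n. f j a \<le> exp (Re (P n 0)))"
      by (rule homog_psh_exp_majorants[OF f(1)[OF j] f(2)[OF j] B[OF j]], rule exI) auto
  qed
  from bchoice[OF this] obtain P :: "'i \<Rightarrow> nat \<Rightarrow> complex \<Rightarrow> complex" where P: "\<And>j n. j \<in> J \<Longrightarrow> P j n holomorphic_on UNIV"
    "\<And>j n \<theta>. j \<in> J \<Longrightarrow> exp (Re (P j n (cis \<theta>))) \<le> B j"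
    "\<And>j \<theta>. j \<in> J \<Longrightarrow> (\<lambda>n. exp (Re (P j n (cis \<theta>)))) \<longlonglongrightarrow> f j (a + cis \<theta> *s b)"
    "\<And>j n. j \<in> J \<Longrightarrow> f j a \<le> exp (Re (P j n 0))"
    by blast
  define Q where "Q = (\<lambda>n \<zeta>. \<Sum>j\<in>J. of_real (\<alpha> j) * P j n \<zeta>)"
  have holQ: "(\<lambda>\<zeta>. exp (Q n \<zeta>)) holomorphic_on UNIV" for n
    unfolding Q_def by (intro holomorphic_intros P)
  have modQ: "cmod (exp (Q n \<zeta>)) = (\<Prod>j\<in>J. exp (Re (P j n \<zeta>)) powr \<alpha> j)" for n \<zeta>
    unfolding norm_exp_eq_Re by (simp add: Q_def exp_sum[OF J] powr_def Re_sum)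
  define C where "C = (\<Prod>j\<in>J. B j powr \<alpha> j)"
  have bd: "cmod (exp (Q n (cis \<theta>))) \<le> C" for n \<theta>
    unfolding modQ C_def using P(2) \<alpha> by (intro prod_mono conjI powr_mono2) (auto intro: less_imp_le)
  have [measurable]: "(\<lambda>\<theta>. exp (Q n (cis \<theta>))) \<in> borel_measurable borel" for n
  proof -
    have "continuous_on UNIV (\<lambda>\<theta>. exp (Q n (cis \<theta>)))"
      by (rule continuous_on_compose2[OF holomorphic_on_imp_continuous_on[OF holQ]]) (auto intro!: continuous_intros)
    then show ?thesis by (rule borel_measurable_continuous_onI)
  qed
  let ?L = "\<Prod>j\<in>J. f j a powr \<alpha> j" and ?g = "\<lambda>\<theta>. \<Prod>j\<in>J. f j (a + cis \<theta> *s b) powr \<alpha> j"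
  have step: "?L \<le> (\<integral>\<theta>. cmod (exp (Q n (cis \<theta>))) \<partial>circ)" for n
  proof -
    have "?L \<le> cmod (exp (Q n 0))"
      unfolding modQ using P(4) \<alpha> nonneg_pshD(1)[OF f(1)]
      by (intro prod_mono conjI powr_mono2) (auto intro: less_imp_le)
    also have "exp (Q n 0) = (\<integral>\<theta>. exp (Q n (cis \<theta>)) \<partial>circ)"
      using holomorphic_circ_mean[OF holQ, of 1 n 0] by simp
    also have "cmod \<dots> \<le> (\<integral>\<theta>. cmod (exp (Q n (cis \<theta>))) \<partial>circ)"
      by (rule integral_norm_bound)
    finally show ?thesis .
  qed
  have gm: "?g \<in> borel_measurable circ"
  proof -
    have [measurable]: "(\<lambda>\<theta>. f j (a + cis \<theta> *s b)) \<in> borel_measurable borel" if "j \<in> J" for j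
      using usc_circle_measurable[OF nonneg_pshD(2)[OF f(1)[OF that]]] .
    show ?thesis by (intro borel_measurable_prod) measurable
  qed
  have lim: "(\<lambda>n. cmod (exp (Q n (cis \<theta>)))) \<longlonglongrightarrow> ?g \<theta>" for \<theta>
    unfolding modQ using P(3) \<alpha> by (intro tendsto_prod tendsto_powr') auto
  have "(\<lambda>n. \<integral>\<theta>. cmod (exp (Q n (cis \<theta>))) \<partial>circ) \<longlonglongrightarrow> (\<integral>\<theta>. ?g \<theta> \<partial>circ)"
    by (rule integral_dominated_convergence[where w = "\<lambda>_. C"]) (use gm lim bd in \<open>auto simp del: norm_exp_eq_Re\<close>)
  then show ?thesis by (rule LIMSEQ_le_const) (use step in auto)
qed

text \<open>Taking values in \<open>ennreal\<close> gives \<open>- ln\<close> the value infinity at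
  zeros and lets integrals exist without integrability. Values above \<open>1\<close> are truncated
  to \<open>0\<close>, so arguments are first divided by an upper bound.\<close>

definition neglog :: "real \<Rightarrow> ennreal" where
  "neglog x = (if x \<le> 0 then \<infinity> else ennreal (- ln x))"

lemma neglog_measurable [measurable]: "neglog \<in> borel_measurable borel"
  unfolding neglog_def by measurable

lemma tendsto_neglog:
  assumes "(\<lambda>n. x n) \<longlonglongrightarrow> y" "\<And>n. 0 < x n"
  shows "(\<lambda>n. ennreal (- ln (x n))) \<longlonglongrightarrow> neglog y"
proof (cases "y \<le> 0")
  case True
  moreover have "y \<ge> 0" using LIMSEQ_le_const[OF assms(1)] assms(2) less_imp_le by blast
  ultimately have y: "y = 0" by simp
  have "filterlim x (at_right 0) sequentially"
    using assms y by (auto simp: filterlim_at less_imp_neq[THEN not_sym])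
  then have "filterlim (\<lambda>n. ln (x n)) at_bot sequentially"
    by (rule filterlim_compose[OF ln_at_0])
  then have "filterlim (\<lambda>n. - ln (x n)) at_top sequentially"
    by (simp add: filterlim_uminus_at_top)
  then show ?thesis using True by (simp add: neglog_def ennreal_tendsto_top_eq_at_top)
next
  case False
  then show ?thesis using assms(1) by (auto simp: neglog_def intro!: tendsto_intros)
qed

text \<open>The functions \<open>ln K - Re (P n)\<close> are nonnegative on the circle and have
  their centre value as exact mean, which is at most that of \<open>- ln (f / K)\<close>. Fatou's
  lemma works in the required direction, bounding the integral of the limit from above.\<close>

lemma neglog_supermean:
  fixes f :: "complex^'n \<Rightarrow> real"
  assumes f: "nonneg_psh f" "homog lam f" and K: "\<And>\<theta>. f (a + cis \<theta> *s b) < K"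
  shows "(\<integral>\<^sup>+\<theta>. neglog (f (a + cis \<theta> *s b) / K) \<partial>circ) \<le> neglog (f a / K)"
proof (rule homog_psh_exp_majorants[OF f K])
  fix P :: "nat \<Rightarrow> complex \<Rightarrow> complex"
  assume P: "\<And>n. P n holomorphic_on UNIV"
    "\<And>n \<theta>. exp (Re (P n (cis \<theta>))) \<le> K"
    "\<And>\<theta>. (\<lambda>n. exp (Re (P n (cis \<theta>)))) \<longlonglongrightarrow> f (a + cis \<theta> *s b)"
    "\<And>n. f a \<le> exp (Re (P n 0))"
  have K0: "K > 0" using K[of 0] nonneg_pshD(1)[OF f(1)] le_less_trans by blast
  let ?e = "\<lambda>n \<theta>. - ln (exp (Re (P n (cis \<theta>))) / K)"
  have e_eq: "?e n \<theta> = ln K - Re (P n (cis \<theta>))" for n \<theta>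
    using K0 by (simp add: ln_div)
  have e_nn: "0 \<le> ?e n \<theta>" for n \<theta>
    using P(2)[of n \<theta>] K0 by (simp add: ln_le_zero_iff del: ln_exp)
  have contP: "continuous_on UNIV (\<lambda>\<theta>. P n (cis \<theta>))" for n
    by (rule continuous_on_compose2[OF holomorphic_on_imp_continuous_on[OF P(1)]]) (auto intro!: continuous_intros)
  have [measurable]: "(\<lambda>\<theta>. P n (cis \<theta>)) \<in> borel_measurable borel" for n
    using contP by (rule borel_measurable_continuous_onI)
  show ?thesis
  proof (cases "f a \<le> 0")
    case True
    then show ?thesis using K0 by (simp add: neglog_def divide_le_0_iff)
  next
    case False
    have "(\<integral>\<^sup>+\<theta>. neglog (f (a + cis \<theta> *s b) / K) \<partial>circ) \<le> (\<integral>\<^sup>+\<theta>. liminf (\<lambda>n. ennreal (?e n \<theta>)) \<partial>circ)"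
    proof (rule nn_integral_mono)
      fix \<theta>
      have "(\<lambda>n. ennreal (?e n \<theta>)) \<longlonglongrightarrow> neglog (f (a + cis \<theta> *s b) / K)"
        using K0 by (intro tendsto_neglog tendsto_divide P(3)) auto
      then show "neglog (f (a + cis \<theta> *s b) / K) \<le> liminf (\<lambda>n. ennreal (?e n \<theta>))"
        by (simp add: lim_imp_Liminf)
    qed
    also have "\<dots> \<le> liminf (\<lambda>n. \<integral>\<^sup>+\<theta>. ennreal (?e n \<theta>) \<partial>circ)"
      unfolding e_eq by (rule nn_integral_liminf) measurable
    also have "\<dots> \<le> neglog (f a / K)"
    proof (rule Liminf_le)
      have "(\<integral>\<^sup>+\<theta>. ennreal (?e n \<theta>) \<partial>circ) \<le> neglog (f a / K)" for n
      proof -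
        have "compact ((\<lambda>\<theta>. P n \<theta>) ` sphere 0 1)"
          by (intro compact_continuous_image continuous_on_subset[OF holomorphic_on_imp_continuous_on[OF P(1)]]) auto
        then have "bounded (P n ` sphere 0 1)" by (rule compact_imp_bounded)
        then obtain C where "\<forall>x\<in>P n ` sphere 0 1. cmod x \<le> C" unfolding bounded_iff by blast
        then have C: "cmod (P n (cis \<theta>)) \<le> C" for \<theta> by simp
        have i: "integrable circ (\<lambda>\<theta>. P n (cis \<theta>))"
          using C by (intro integrable_circ_bounded[of _ C]) auto
        have "has_bochner_integral circ (\<lambda>\<theta>. ln K - Re (P n (cis \<theta>))) (ln K - Re (P n 0))"
          using holomorphic_circ_mean[OF P(1), of 1 n 0]
          by (intro has_bochner_integral_diff has_bochner_integral_circ_const)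
             (simp add: has_bochner_integral_iff integral_Re[OF i] integrable_Re[OF i])
        then have "(\<integral>\<^sup>+\<theta>. ennreal (?e n \<theta>) \<partial>circ) = ennreal (ln K - Re (P n 0))"
          using e_nn[of n] unfolding e_eq
          by (subst nn_integral_eq_integral) (auto simp: has_bochner_integral_iff)
        also have "\<dots> \<le> ennreal (ln K - ln (f a))"
        proof -
          have "ln (f a) \<le> Re (P n 0)" using P(4)[of n] False by (simp add: ln_ge_iff ln_le_cancel_iff[symmetric])
          then show ?thesis by (simp add: ennreal_leI)
        qed
        also have "\<dots> = neglog (f a / K)" using False K0 by (simp add: neglog_def ln_div divide_le_0_iff)
        finally show ?thesis .
      qed
      then show "\<forall>\<^sub>F n in sequentially. (\<integral>\<^sup>+\<theta>. ennreal (?e n \<theta>) \<partial>circ) \<le> neglog (f a / K)" by simp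
    qed simp
    finally show ?thesis .
  qed
qed

section \<open>From circle means to ball means\<close>

lemma nn_integral_lborel_rotate:
  fixes g :: "complex^'n \<Rightarrow> ennreal"
  assumes [measurable]: "g \<in> borel_measurable borel"
  shows "(\<integral>\<^sup>+z. g (cis \<theta> *s z) \<partial>lborel) = (\<integral>\<^sup>+z. g z \<partial>lborel)"
proof -
  have lin: "linear (\<lambda>z::complex^'n. cis \<theta> *s z)"
    by (rule linearI) (auto simp: vec_eq_iff algebra_simps scaleR_conv_of_real)
  have [measurable]: "(\<lambda>z::complex^'n. cis \<theta> *s z) \<in> borel \<rightarrow>\<^sub>M borel"
    by (intro borel_measurable_continuous_onI continuous_intros)
  have "(\<integral>\<^sup>+z. g z \<partial>lborel) = (\<integral>\<^sup>+z. g z \<partial>distr lborel borel (\<lambda>z. cis \<theta> *s z))"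
    by (subst lborel_distr_isometry[OF lin]) (auto simp: norm_vector_smult)
  also have "\<dots> = (\<integral>\<^sup>+z. g (cis \<theta> *s z) \<partial>lborel)"
    by (subst nn_integral_distr) auto
  finally show ?thesis ..
qed

text \<open>Polar coordinates are avoided: the integral over the ball is unchanged when its points
  are rotated by \<open>cis \<theta>\<close>, so it equals its own average over
  \<open>\<theta>\<close>. After Fubini the inner integral is a circle mean about
  \<open>a\<close>.\<close>

lemma supermean_ball:
  fixes g :: "complex^'n \<Rightarrow> ennreal"
  assumes g: "g \<in> borel_measurable borel"
    and sm: "\<And>b. norm b < R \<Longrightarrow> (\<integral>\<^sup>+\<theta>. g (a + cis \<theta> *s b) \<partial>circ) \<le> g a"
  shows "(\<integral>\<^sup>+z\<in>ball a R. g z \<partial>lborel) \<le> emeasure lborel (ball a R) * g a"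
proof -
  let ?i = "indicator (ball (0::complex^'n) R) :: _ \<Rightarrow> ennreal"
  have im: "?i \<in> borel_measurable borel" by (rule borel_measurable_indicator[OF borel_open[OF open_ball]])
  have translate: "(\<integral>\<^sup>+z. h z \<partial>lborel) = (\<integral>\<^sup>+z. h (a + z) \<partial>lborel)" if h: "h \<in> borel_measurable borel"
    for h :: "complex^'n \<Rightarrow> ennreal"
  proof -
    have "(\<integral>\<^sup>+z. h z \<partial>lborel) = (\<integral>\<^sup>+z. h z \<partial>distr lborel borel ((+) a))" by (simp add: lborel_distr_plus)
    also have "\<dots> = (\<integral>\<^sup>+z. h (a + z) \<partial>lborel)" using h by (subst nn_integral_distr) auto
    finally show ?thesis .
  qed
  have ball_shift: "indicator (ball a R) (a + z) = ?i z" for z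
    by (auto simp: indicator_def dist_norm)
  have shift: "(\<lambda>z. g (a + z)) \<in> borel_measurable borel"
    using g by (intro measurable_compose[OF _ g]) auto
  have rot: "?i (cis \<theta> *s z) = ?i z" for \<theta> z
    by (auto simp: indicator_def norm_vector_smult)
  interpret P: pair_sigma_finite circ "lborel :: (complex^'n) measure" ..
  have "continuous_on UNIV (\<lambda>p::real \<times> (complex^'n). a + cis (fst p) *s snd p)"
    by (intro continuous_intros)
  then have "(\<lambda>p::real \<times> (complex^'n). a + cis (fst p) *s snd p) \<in> borel \<rightarrow>\<^sub>M borel"
    by (rule borel_measurable_continuous_onI)
  then have mp: "(\<lambda>p::real \<times> (complex^'n). a + cis (fst p) *s snd p) \<in> circ \<Otimes>\<^sub>M lborel \<rightarrow>\<^sub>M borel"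
    by (simp add: borel_prod[symmetric] cong: measurable_cong_sets sets_pair_measure_cong)
  have m: "(\<lambda>(\<theta>, z). g (a + cis \<theta> *s z) * ?i z) \<in> borel_measurable (circ \<Otimes>\<^sub>M lborel)"
    unfolding case_prod_beta
    by (intro borel_measurable_times_ennreal measurable_compose[OF mp g] measurable_compose[OF _ im]) simp
  have "(\<integral>\<^sup>+z\<in>ball a R. g z \<partial>lborel) = (\<integral>\<^sup>+z. g (a + z) * ?i z \<partial>lborel)"
    by (subst translate) (simp_all only: ball_shift borel_measurable_times_ennreal g
        borel_measurable_indicator[OF borel_open[OF open_ball]])
  also have "\<dots> = (\<integral>\<^sup>+\<theta>. (\<integral>\<^sup>+z. g (a + z) * ?i z \<partial>lborel) \<partial>circ)"
    by simp
  also have "\<dots> = (\<integral>\<^sup>+\<theta>. (\<integral>\<^sup>+z. g (a + cis \<theta> *s z) * ?i (cis \<theta> *s z) \<partial>lborel) \<partial>circ)"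
    by (intro nn_integral_cong nn_integral_lborel_rotate[symmetric] borel_measurable_times_ennreal shift im)
  also have "\<dots> = (\<integral>\<^sup>+\<theta>. (\<integral>\<^sup>+z. g (a + cis \<theta> *s z) * ?i z \<partial>lborel) \<partial>circ)"
    by (simp only: rot)
  also have "\<dots> = (\<integral>\<^sup>+z. (\<integral>\<^sup>+\<theta>. g (a + cis \<theta> *s z) * ?i z \<partial>circ) \<partial>lborel)"
    by (rule P.Fubini'[OF m, symmetric])
  also have "\<dots> \<le> (\<integral>\<^sup>+z. g a * ?i z \<partial>lborel)"
  proof (rule nn_integral_mono)
    fix z
    show "(\<integral>\<^sup>+\<theta>. g (a + cis \<theta> *s z) * ?i z \<partial>circ) \<le> g a * ?i z"
      using sm[of z] by (cases "norm z < R") auto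
  qed
  also have "\<dots> = g a * emeasure lborel (ball (0::complex^'n) R)"
    by (simp add: nn_integral_cmult_indicator)
  also have "emeasure lborel (ball (0::complex^'n) R) = (\<integral>\<^sup>+z. indicator (ball a R) (a + z) \<partial>lborel)"
    unfolding ball_shift by simp
  also have "\<dots> = emeasure lborel (ball a R)"
    by (subst translate[symmetric])
       (simp_all add: borel_measurable_indicator[OF borel_open[OF open_ball]])
  finally show ?thesis by (simp add: mult.commute)
qed

section \<open>Infinite weighted geometric means\<close>

locale product_sequence =
  fixes lam :: "real^'n" and f :: "nat \<Rightarrow> complex^'n \<Rightarrow> real"
  assumes psh: "\<And>j. nonneg_psh (f j)" and hom: "\<And>j. homog lam (f j)"
    and loc_bdd: "\<And>R. \<exists>K\<ge>1. \<forall>j z. norm z \<le> R \<longrightarrow> f j z \<le> K"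
begin

definition W :: "nat \<Rightarrow> complex^'n \<Rightarrow> real" where
  "W m z = (\<Prod>j<m. f j z powr (1/2)^(j+1))"

definition v :: "complex^'n \<Rightarrow> real" where
  "v z = lim (\<lambda>m. W m z)"

lemma f_nonneg: "0 \<le> f j z" and f_usc: "usc (f j)"
  using nonneg_pshD[OF psh] by auto

lemma W_nonneg: "0 \<le> W m z"
  by (simp add: W_def prod_nonneg)

lemma W_usc: "usc (W m)"
  unfolding W_def by (intro usc_prod_nonneg usc_powr f_usc f_nonneg) auto

lemma W_submean: "W m a \<le> (\<integral>\<theta>. W m (a + cis \<theta> *s b) \<partial>circ)"
  unfolding W_def using psh hom by (intro psh_product_submean) auto

text \<open>The factors not yet included carry total weight \<open>(1/2)^m\<close> and each base is
  at most \<open>K\<close>, so \<open>K powr (1/2)^m\<close> pays for them in advance. This makes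
  the partial products monotone, although single factors may exceed \<open>1\<close>.\<close>

lemma scaled_W_antimono:
  assumes "K \<ge> 1" "\<And>j. f j z \<le> K"
  shows "decseq (\<lambda>m. K powr (1/2)^m * W m z)"
proof (rule decseq_SucI)
  fix m
  have "K powr (1/2)^(Suc m) * W (Suc m) z = K powr (1/2)^(Suc m) * f m z powr (1/2)^(m+1) * W m z"
    by (simp add: W_def)
  also have "\<dots> \<le> K powr (1/2)^(Suc m) * K powr (1/2)^(m+1) * W m z"
    using assms f_nonneg W_nonneg by (intro mult_right_mono mult_left_mono powr_mono2) auto
  also have "K powr (1/2)^(Suc m) * K powr (1/2)^(m+1) = K powr (1/2)^m"
    by (simp flip: powr_add)
  finally show "K powr (1/2)^(Suc m) * W (Suc m) z \<le> K powr (1/2)^m * W m z" .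
qed

lemma scaling_tendsto: "K \<ge> 1 \<Longrightarrow> (\<lambda>m. K powr (1/2::real)^m) \<longlonglongrightarrow> 1"
  by (auto intro!: tendsto_eq_intros LIMSEQ_power_zero)

lemma W_tendsto: "(\<lambda>m. W m z) \<longlonglongrightarrow> v z"
  and v_le: "K \<ge> 1 \<Longrightarrow> (\<And>j. f j z \<le> K) \<Longrightarrow> v z \<le> K powr (1/2)^m * W m z"
proof -
  have *: "(\<lambda>m. W m z) \<longlonglongrightarrow> v z \<and> v z \<le> K powr (1/2)^m * W m z"
    if K: "K \<ge> 1" "\<And>j. f j z \<le> K" for K m
  proof -
    let ?V = "\<lambda>m. K powr (1/2)^m * W m z"
    obtain L where L: "?V \<longlonglongrightarrow> L" "\<And>m. L \<le> ?V m"
      using decseq_convergent[OF scaled_W_antimono[OF K], of 0] W_nonneg by auto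
    have "(\<lambda>m. ?V m / K powr (1/2)^m) \<longlonglongrightarrow> L / 1"
      using L(1) scaling_tendsto[OF K(1)] by (intro tendsto_divide) auto
    then have "(\<lambda>m. W m z) \<longlonglongrightarrow> L" using K(1) by simp
    moreover from this have "v z = L" unfolding v_def by (rule limI)
    ultimately show ?thesis using L(2) by simp
  qed
  show "(\<lambda>m. W m z) \<longlonglongrightarrow> v z" using loc_bdd[of "norm z"] * by blast
  show "K \<ge> 1 \<Longrightarrow> (\<And>j. f j z \<le> K) \<Longrightarrow> v z \<le> K powr (1/2)^m * W m z" using * by blast
qed

lemma v_nonneg: "0 \<le> v z"
  using LIMSEQ_le_const[OF W_tendsto] W_nonneg by blast

lemma W_le:
  assumes "K \<ge> 1" "\<And>j. f j z \<le> K"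
  shows "W m z \<le> K"
proof -
  have "K powr (1/2)^m \<ge> 1" using assms(1) by (simp add: ge_one_powr_ge_zero)
  then have "W m z \<le> K powr (1/2)^m * W m z"
    using W_nonneg[of m z] by (simp add: mult_le_cancel_right1)
  also have "\<dots> \<le> K powr (1/2)^0 * W 0 z"
    using scaled_W_antimono[OF assms] by (rule decseqD) simp
  finally show ?thesis using assms(1) by (simp add: W_def)
qed

text \<open>On a neighbourhood with a common bound \<open>K\<close>, \<open>v\<close> lies below
  every corrected partial product. These are upper semicontinuous and converge to \<open>v z\<close>
  at \<open>z\<close>, so one of them already certifies the bound \<open>c\<close> nearby.\<close>

lemma v_usc: "usc v"
proof -
  have "\<forall>\<^sub>F w in nhds z. v w < c" if c: "v z < c" for z c
  proof -
    obtain K where K: "K \<ge> 1" "\<And>j w. norm w \<le> norm z + 1 \<Longrightarrow> f j w \<le> K"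
      using loc_bdd by metis
    have "(\<lambda>m. K powr (1/2)^m * W m z) \<longlonglongrightarrow> 1 * v z"
      by (intro tendsto_mult scaling_tendsto K W_tendsto)
    then have "\<forall>\<^sub>F m in sequentially. K powr (1/2)^m * W m z < c"
      using c by (intro order_tendstoD) auto
    then obtain m where m: "K powr (1/2)^m * W m z < c"
      by (auto simp: eventually_sequentially)
    have "\<forall>\<^sub>F w in nhds z. K powr (1/2)^m * W m w < c"
      by (rule uscD[OF usc_mult_nonneg[OF usc_const W_usc] m]) (auto simp: W_nonneg)
    moreover have "\<forall>\<^sub>F w in nhds z. dist w z < 1"
      by (auto simp: eventually_nhds_metric intro!: exI[of _ 1])
    ultimately show ?thesis
    proof eventually_elim
      case (elim w)
      have "norm w \<le> norm z + 1"
        using elim(2) norm_triangle_ineq[of z "w - z"] by (simp add: dist_norm)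
      then have "v w \<le> K powr (1/2)^m * W m w" using K by (intro v_le) auto
      with elim(1) show ?case by simp
    qed
  qed
  then show ?thesis by (simp add: usc_def)
qed

lemma v_submean: "v a \<le> (\<integral>\<theta>. v (a + cis \<theta> *s b) \<partial>circ)"
proof -
  obtain K where K: "K \<ge> 1" "\<And>j w. norm w \<le> norm a + norm b \<Longrightarrow> f j w \<le> K"
    using loc_bdd by metis
  have nb: "norm (a + cis \<theta> *s b) \<le> norm a + norm b" for \<theta>
    using circle_in_cball[of a \<theta> b] by simp
  have "(\<lambda>m. \<integral>\<theta>. W m (a + cis \<theta> *s b) \<partial>circ) \<longlonglongrightarrow> (\<integral>\<theta>. v (a + cis \<theta> *s b) \<partial>circ)"
    by (rule integral_dominated_convergence[where w = "\<lambda>_. K"])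
       (use W_nonneg W_le[OF K(1) K(2)[OF nb]] usc_circle_measurable[OF v_usc] usc_circle_measurable[OF W_usc]
          W_tendsto in auto)
  then show ?thesis
    by (rule LIMSEQ_le[OF W_tendsto]) (use W_submean in auto)
qed

lemma v_psh: "nonneg_psh v"
  by (simp add: nonneg_psh_def submean_def v_nonneg v_usc v_submean)

text \<open>The partial product \<open>W m\<close> scales with exponent \<open>1 - (1/2)^m\<close>;
  degree one is reached only in the limit.\<close>

lemma v_homog: "homog lam v"
proof -
  have "v (Phi lam z t) = exp (- Re t) * v z" for z t
  proof (rule LIMSEQ_unique[OF W_tendsto])
    have ex: "(\<Sum>j<m. (1/2)^(j+1)) = 1 - (1/2::real)^m" for m
      by (induction m) (auto simp: field_simps)
    have "W m (Phi lam z t) = exp (- Re t * (1 - (1/2)^m)) * W m z" for m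
    proof -
      have "W m (Phi lam z t) = (\<Prod>j<m. exp (- Re t) powr (1/2)^(j+1)) * W m z"
        unfolding W_def by (simp add: homogD[OF hom] powr_mult f_nonneg prod.distrib)
      also have "(\<Prod>j<m. exp (- Re t) powr (1/2)^(j+1)) = exp (\<Sum>j<m. - Re t * (1/2)^(j+1))"
        by (simp add: exp_sum powr_def mult.commute)
      also have "(\<Sum>j<m. - Re t * (1/2)^(j+1)) = - Re t * (1 - (1/2)^m)"
        unfolding ex[symmetric] by (rule sum_distrib_left[symmetric])
      finally show ?thesis .
    qed
    moreover have "(\<lambda>m. exp (- Re t * (1 - (1/2)^m)) * W m z) \<longlonglongrightarrow> exp (- Re t * (1 - 0)) * v z"
      by (intro tendsto_intros W_tendsto LIMSEQ_power_zero) auto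
    ultimately show "(\<lambda>m. W m (Phi lam z t)) \<longlonglongrightarrow> exp (- Re t) * v z" by simp
  qed
  then show ?thesis by (simp add: homog_def)
qed

text \<open>Weight and decay cancel: \<open>exp (- (2^(j+1)))\<close> raised to the power
  \<open>(1/2)^(j+1)\<close> is \<open>exp (-1)\<close>. Each new factor thus costs a fixed ratio,
  while the powers of \<open>U\<close> stay bounded because their exponents sum to less than
  \<open>1\<close>.\<close>

lemma v_zero:
  assumes U: "U \<ge> 0" and le: "\<And>j. f j z \<le> U * exp (- (2^(j+1)))"
  shows "v z = 0"
proof -
  \<comment> \<open>A base of at least \<open>1\<close> is needed so that raising the exponent
    \<open>1 - (1/2)^m\<close> to \<open>1\<close> can only increase the power.\<close>
  have "W m z \<le> max U 1 * exp (- real m)" for m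
  proof -
    have "W m z \<le> (\<Prod>j<m. (max U 1 * exp (- (2^(j+1)))) powr (1/2)^(j+1))"
      unfolding W_def
    proof (intro prod_mono conjI powr_mono2)
      fix j
      have "U * exp (- (2^(j+1))) \<le> max U 1 * exp (- (2^(j+1)))" by (intro mult_right_mono) auto
      then show "f j z \<le> max U 1 * exp (- (2^(j+1)))" using le[of j] by linarith
    qed (auto simp: f_nonneg)
    also have "\<dots> = (\<Prod>j<m. max U 1 powr (1/2)^(j+1)) * (\<Prod>j<m. exp (-1))"
    proof -
      have "exp (- (2^(j+1))) powr (1/2::real)^(j+1) = exp (-1)" for j
      proof -
        have "(1/2::real)^(j+1) * (- (2^(j+1))) = - 1" by (simp add: power_one_over)
        then show ?thesis by (simp only: powr_def ln_exp exp_not_eq_zero if_False)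
      qed
      then show ?thesis by (simp add: powr_mult prod.distrib)
    qed
    also have "(\<Prod>j<m. max U 1 powr (1/2)^(j+1)) = max U 1 powr (\<Sum>j<m. (1/2)^(j+1))"
      by (simp add: powr_sum)
    also have "(\<Sum>j<m. (1/2)^(j+1)) = 1 - (1/2::real)^m"
      by (induction m) (auto simp: field_simps)
    also have "max U 1 powr (1 - (1/2)^m) * (\<Prod>j<m. exp (-1)) \<le> max U 1 powr 1 * exp (- real m)"
      by (intro mult_mono powr_mono) (auto simp: exp_of_nat_mult[symmetric])
    finally show ?thesis by simp
  qed
  moreover have "(\<lambda>m. max U 1 * exp (- real m)) \<longlonglongrightarrow> 0"
    by (intro tendsto_mult_right_zero filterlim_compose[OF exp_at_bot])
       (simp add: filterlim_uminus_at_bot filterlim_real_sequentially)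
  ultimately have "v z \<le> 0"
    using LIMSEQ_le[OF W_tendsto] by blast
  then show ?thesis using v_nonneg[of z] by simp
qed

text \<open>Superharmonicity of \<open>- ln (f j)\<close> over a ball around a point where \<open>f j = 1\<close> bounds the mass
  of \<open>- ln (f j)\<close> on a fixed ball uniformly in \<open>j\<close>.\<close>

lemma v_nonzero:
  assumes w: "\<And>j. norm (w j) \<le> 1" "\<And>j. 1 \<le> f j (w j)"
  shows "\<exists>z. v z \<noteq> 0"
proof -
  \<comment> \<open>Since \<open>w j\<close> lies in the closed unit ball, a ball of radius
    \<open>2\<close> about it contains the open unit ball and stays within radius
    \<open>3\<close>.\<close>
  obtain K0 where K0: "K0 \<ge> 1" "\<And>j z. norm z \<le> 3 \<Longrightarrow> f j z \<le> K0" using loc_bdd by metis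
  define K where "K = K0 + 1"
  have K: "K > 1" "\<And>j z. norm z \<le> 3 \<Longrightarrow> f j z < K"
    using K0 unfolding K_def by (simp, meson less_add_one le_less_trans)
  define g where "g = (\<lambda>j z. neglog (f j z / K))"
  have gm: "g j \<in> borel_measurable borel" for j
    unfolding g_def using usc_borel_measurable[OF f_usc[of j]] by measurable
  let ?B = "ball (0::complex^'n) 1"
  define C where "C = emeasure lborel (ball (0::complex^'n) 2) * ennreal (ln K)"
  have C: "C < \<infinity>"
    unfolding C_def using emeasure_lborel_ball_finite[of "0::complex^'n" 2]
    by (simp add: ennreal_mult_less_top)
  have mass: "(\<integral>\<^sup>+z\<in>?B. g j z \<partial>lborel) \<le> C" for j
  proof -
    have "(\<integral>\<^sup>+z\<in>?B. g j z \<partial>lborel) \<le> (\<integral>\<^sup>+z\<in>ball (w j) 2. g j z \<partial>lborel)"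
    proof (intro nn_integral_mono mult_left_mono)
      fix z :: "complex^'n"
      have "norm (w j - z) \<le> norm (w j) + norm z" by (rule norm_triangle_ineq4)
      then show "(indicator ?B z :: ennreal) \<le> indicator (ball (w j) 2) z"
        using w(1)[of j] by (auto simp: indicator_def dist_norm)
    qed auto
    also have "\<dots> \<le> emeasure lborel (ball (w j) 2) * g j (w j)"
    proof (rule supermean_ball[OF gm])
      fix b :: "complex^'n" assume b: "norm b < 2"
      have "f j (w j + cis \<theta> *s b) < K" for \<theta>
        using circle_in_cball[of "w j" \<theta> b] b w(1)[of j] by (intro K) auto
      then show "(\<integral>\<^sup>+\<theta>. g j (w j + cis \<theta> *s b) \<partial>circ) \<le> g j (w j)"
        unfolding g_def by (rule neglog_supermean[OF psh hom])
    qed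
    also have "emeasure lborel (ball (w j) 2) = emeasure lborel (ball (0::complex^'n) 2)"
      by (simp add: emeasure_ball)
    also have "g j (w j) \<le> ennreal (ln K)"
    proof -
      have "0 \<le> ln (f j (w j))" using w(2)[of j] by simp
      then show ?thesis
        unfolding g_def neglog_def using w(2)[of j] K(1)
        by (auto simp: ln_div divide_le_0_iff intro!: ennreal_leI)
    qed
    finally show ?thesis unfolding C_def by (simp add: mult_left_mono)
  qed
  \<comment> \<open>On the unit ball \<open>G\<close> dominates \<open>- ln (W m z)\<close> for
    every \<open>m\<close>, up to terms \<open>ln K\<close> of favourable sign. A point where
    \<open>G\<close> is finite therefore gives a positive lower bound for all partial products, and
    finiteness somewhere follows from a finite integral.\<close>
  define G where "G = (\<lambda>z. \<Sum>j. ennreal ((1/2)^(j+1)) * g j z)"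
  have Gm: "G \<in> borel_measurable borel" unfolding G_def using gm by measurable
  have iB: "(indicator ?B :: complex^'n \<Rightarrow> ennreal) \<in> borel_measurable borel"
    by (rule borel_measurable_indicator[OF borel_open[OF open_ball]])
  have "(\<integral>\<^sup>+z\<in>?B. G z \<partial>lborel) = (\<integral>\<^sup>+z. (\<Sum>j. ennreal ((1/2)^(j+1)) * (g j z * indicator ?B z)) \<partial>lborel)"
    unfolding G_def by (simp add: ennreal_suminf_multc[symmetric] mult.assoc)
  also have "\<dots> = (\<Sum>j. \<integral>\<^sup>+z. ennreal ((1/2)^(j+1)) * (g j z * indicator ?B z) \<partial>lborel)"
    using gm iB by (intro nn_integral_suminf) simp
  also have "\<dots> = (\<Sum>j. ennreal ((1/2)^(j+1)) * (\<integral>\<^sup>+z\<in>?B. g j z \<partial>lborel))"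
    using gm iB by (simp add: nn_integral_cmult)
  also have "\<dots> \<le> (\<Sum>j. ennreal ((1/2)^(j+1)) * C)"
    using mass by (intro suminf_le mult_left_mono) auto
  also have "\<dots> = (\<Sum>j. ennreal ((1/2)^(j+1))) * C"
    by (rule ennreal_suminf_multc)
  also have "(\<Sum>j. ennreal ((1/2::real)^(j+1))) = 1"
  proof -
    have "(\<lambda>j. (1/2::real)^(j+1)) sums 1" using power_half_series by simp
    then show ?thesis by (subst suminf_ennreal_eq) auto
  qed
  finally have fin: "(\<integral>\<^sup>+z\<in>?B. G z \<partial>lborel) \<noteq> \<infinity>" using C by auto
  have "\<exists>z\<in>?B. G z \<noteq> \<infinity>"
  proof (rule ccontr)
    assume "\<not> ?thesis"
    then have "(\<integral>\<^sup>+z\<in>?B. G z \<partial>lborel) = (\<integral>\<^sup>+z. \<infinity> * indicator ?B z \<partial>lborel)"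
      by (intro nn_integral_cong) (auto simp: indicator_def)
    also have "\<dots> = \<infinity> * emeasure lborel ?B"
      by (rule nn_integral_cmult_indicator) simp
    also have "\<dots> = \<infinity>"
      using content_ball_pos[of 1 "0::complex^'n"] by (auto simp: measure_def ennreal_top_mult)
    finally show False using fin by simp
  qed
  then obtain z where z: "norm z < 1" "G z < \<infinity>" by (auto simp: less_top)
  define r where "r = enn2real (G z)"
  have r: "G z = ennreal r" "r \<ge> 0" using z(2) by (auto simp: r_def)
  have fpos: "f j z > 0" for j
  proof (rule ccontr)
    assume "\<not> f j z > 0"
    then have "f j z = 0" using f_nonneg[of j z] by simp
    then have "ennreal ((1/2)^(j+1)) * g j z = \<infinity>" by (simp add: g_def neglog_def ennreal_mult_top)
    moreover have "ennreal ((1/2)^(j+1)) * g j z \<le> G z"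
      unfolding G_def by (rule sum_le_suminf[of _ "{j}", simplified]) auto
    ultimately show False using z(2) by (simp add: top_unique)
  qed
  have gz: "g j z = ennreal (- ln (f j z / K))" and gz0: "0 \<le> - ln (f j z / K)" for j
    using fpos[of j] K(2)[of z j] z(1) K(1) by (auto simp: g_def neglog_def divide_le_0_iff)
  have "exp (- r) \<le> W m z" for m
  proof -
    have "ennreal (\<Sum>j<m. (1/2)^(j+1) * (- ln (f j z / K))) = (\<Sum>j<m. ennreal ((1/2)^(j+1)) * g j z)"
    proof -
      have nn: "0 \<le> (1/2)^(j+1) * (- ln (f j z / K))" for j
        by (intro mult_nonneg_nonneg gz0) simp
      have "ennreal ((1/2)^(j+1)) * g j z = ennreal ((1/2)^(j+1) * (- ln (f j z / K)))" for j
        unfolding gz by (intro ennreal_mult[symmetric] gz0) simp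
      then show ?thesis by (simp only: sum_ennreal[OF nn])
    qed
    also have "\<dots> \<le> G z" unfolding G_def by (rule sum_le_suminf) auto
    finally have "(\<Sum>j<m. (1/2)^(j+1) * (- ln (f j z / K))) \<le> r"
      using r by (simp add: ennreal_le_iff)
    then have "exp (- r) \<le> exp (\<Sum>j<m. (1/2)^(j+1) * ln (f j z / K))"
      by (simp add: sum_negf)
    also have "\<dots> \<le> exp (\<Sum>j<m. (1/2)^(j+1) * ln (f j z))"
    proof -
      have "ln (f j z / K) \<le> ln (f j z)" for j
        using fpos[of j] K(1) by (simp add: ln_div)
      then show ?thesis by (auto intro!: sum_mono mult_left_mono)
    qed
    also have "\<dots> = W m z"
      unfolding W_def powr_def using fpos by (simp add: exp_sum less_imp_neq[THEN not_sym])
    finally show ?thesis .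
  qed
  then have "exp (- r) \<le> v z" using LIMSEQ_le_const[OF W_tendsto] by blast
  then have "v z \<noteq> 0" using exp_gt_zero[of "- r"] by linarith
  then show ?thesis ..
qed

end

section \<open>Real-valued members of the homogeneous class\<close>

lemma circle_mean_ereal:
  fixes f :: "complex^'n \<Rightarrow> real"
  assumes f: "usc f" "\<And>z. 0 \<le> f z"
  shows "circle_mean (\<lambda>z. ereal (f z)) a b = ereal (\<integral>\<theta>. f (a + cis \<theta> *s b) \<partial>circ)"
proof -
  let ?h = "\<lambda>\<theta>. f (a + cis \<theta> *s b)"
  have hm: "?h \<in> borel_measurable borel" by (rule usc_circle_measurable[OF f(1)])
  obtain M where M: "\<And>\<theta>. ?h \<theta> \<le> M" using usc_circle_bounded[OF f(1)] by blast
  have int: "integrable lborel (\<lambda>\<theta>. indicator {0..2*pi} \<theta> *\<^sub>R ?h \<theta>)"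
    by (rule integrableI_bounded_set_indicator[where B = M]) (use hm M f(2) in auto)
  have "(\<integral>\<^sup>+\<theta>\<in>{0..2*pi}. ennreal (?h \<theta>) \<partial>lborel) = (\<integral>\<^sup>+\<theta>. ennreal (indicator {0..2*pi} \<theta> *\<^sub>R ?h \<theta>) \<partial>lborel)"
    by (intro nn_integral_cong) (auto simp: indicator_def)
  also have "\<dots> = ennreal (\<integral>\<theta>. indicator {0..2*pi} \<theta> *\<^sub>R ?h \<theta> \<partial>lborel)"
    using f(2) by (intro nn_integral_eq_integral[OF int]) auto
  also have "(\<integral>\<theta>. indicator {0..2*pi} \<theta> *\<^sub>R ?h \<theta> \<partial>lborel) = 2 * pi * (\<integral>\<theta>. ?h \<theta> \<partial>circ)"
    by (simp add: integral_circ[OF hm])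
  finally have I: "(\<integral>\<^sup>+\<theta>\<in>{0..2*pi}. ennreal (?h \<theta>) \<partial>lborel) = ennreal (2 * pi * (\<integral>\<theta>. ?h \<theta> \<partial>circ))" .
  have nn: "0 \<le> (\<integral>\<theta>. ?h \<theta> \<partial>circ)" using f(2) by (intro integral_nonneg_AE) auto
  have pos: "e2ennreal (max 0 (ereal (f z))) = ennreal (f z)" for z
    using f(2)[of z] by (simp add: max_def)
  have neg: "e2ennreal (max 0 (- ereal (f z))) = 0" for z
    using f(2)[of z] by (simp add: max_def zero_ereal_def)
  show ?thesis
    unfolding circle_mean_def cis_conv_exp[symmetric] pos neg I using nn
    by (simp add: enn2ereal_ennreal zero_ennreal.rep_eq)
qed

text \<open>The punctured filter of the given definition suffices: the condition at \<open>z\<close>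
  itself is the hypothesis \<open>f z < c\<close>.\<close>

lemma usc_iff_Limsup:
  "usc f \<longleftrightarrow> (\<forall>z. Limsup (at z) (\<lambda>w. ereal (f w)) \<le> ereal (f z))"
proof
  assume f: "usc f"
  show "\<forall>z. Limsup (at z) (\<lambda>w. ereal (f w)) \<le> ereal (f z)"
  proof (intro allI, subst Limsup_le_iff, intro allI impI)
    fix z y assume y: "ereal (f z) < y"
    obtain c where c: "ereal (f z) < ereal c" "ereal c < y"
      using ereal_dense2[OF y] by blast
    then have "\<forall>\<^sub>F w in nhds z. f w < c" by (intro uscD[OF f]) simp
    then have "\<forall>\<^sub>F w in at z. f w < c" by (simp add: eventually_nhds_conv_at)
    then show "\<forall>\<^sub>F w in at z. ereal (f w) < y"
      by eventually_elim (use c in \<open>auto intro: less_trans[of _ "ereal c"]\<close>)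
  qed
next
  assume L: "\<forall>z. Limsup (at z) (\<lambda>w. ereal (f w)) \<le> ereal (f z)"
  show "usc f"
    unfolding usc_def
  proof (intro allI impI)
    fix z c assume c: "f z < c"
    then have "ereal (f z) < ereal c" by simp
    then have "\<forall>\<^sub>F w in at z. ereal (f w) < ereal c"
      using L[rule_format, of z] unfolding Limsup_le_iff by blast
    then show "\<forall>\<^sub>F w in nhds z. f w < c" using c by (simp add: eventually_nhds_conv_at)
  qed
qed

lemma Phi_zero [simp]: "Phi lam 0 t = 0"
  by (simp add: Phi_def vec_eq_iff)

lemma Phi_inverse: "Phi lam (Phi lam z t) (- t) = z" "Phi lam (Phi lam z (- t)) t = z"
  by (simp_all add: Phi_def vec_eq_iff exp_minus)

lemma homog_zero: "homog lam f \<Longrightarrow> f 0 = 0"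
  using homogD[of lam f 0 1] by simp

text \<open>Nonconstancy turns into not vanishing identically because the flow fixes the origin,
  where homogeneity forces the value \<open>0\<close>. Values are finite and nonnegative, so nothing
  is lost by passing to the reals.\<close>

lemma H_lam_iff:
  "v \<in> H_lam lam \<longleftrightarrow> (\<exists>f. nonneg_psh f \<and> homog lam f \<and> (\<exists>z. f z \<noteq> 0) \<and> v = (\<lambda>z. ereal (f z)))"
proof
  assume v: "v \<in> H_lam lam"
  define f where "f = (\<lambda>z. real_of_ereal (v z))"
  have "v z = ereal (f z)" for z
  proof -
    have "0 \<le> v z" "v z < \<infinity>" using v by (auto simp: H_lam_def psh_def)
    then show ?thesis unfolding f_def by (cases "v z") auto
  qed
  then have vf: "v = (\<lambda>z. ereal (f z))" by auto
  note v' = v[unfolded H_lam_def psh_def vf]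
  have us: "usc f" using v' by (simp add: usc_iff_Limsup)
  have nn: "0 \<le> f z" for z using v' by auto
  have "f a \<le> (\<integral>\<theta>. f (a + cis \<theta> *s b) \<partial>circ)" for a b
    using v' by (simp add: circle_mean_ereal[OF us nn])
  moreover have "homog lam f" using v' by (simp add: homog_def)
  moreover have "\<exists>z. f z \<noteq> 0" using v' by auto metis
  ultimately show "\<exists>f. nonneg_psh f \<and> homog lam f \<and> (\<exists>z. f z \<noteq> 0) \<and> v = (\<lambda>z. ereal (f z))"
    using us nn vf by (auto simp: nonneg_psh_def submean_def)
next
  assume "\<exists>f. nonneg_psh f \<and> homog lam f \<and> (\<exists>z. f z \<noteq> 0) \<and> v = (\<lambda>z. ereal (f z))"
  then obtain f z where f: "nonneg_psh f" "homog lam f" "f z \<noteq> 0" and v: "v = (\<lambda>z. ereal (f z))" by blast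
  have "f z \<noteq> f 0" using f(3) homog_zero[OF f(2)] by simp
  then have "\<exists>z w. v z \<noteq> v w" unfolding v by auto
  moreover have "v a \<le> circle_mean v a b" for a b
    unfolding v using nonneg_pshD[OF f(1)] by (simp add: circle_mean_ereal)
  moreover have "\<forall>z. Limsup (at z) v \<le> v z"
    unfolding v using nonneg_pshD(2)[OF f(1)] by (simp add: usc_iff_Limsup)
  ultimately show "v \<in> H_lam lam"
    using nonneg_pshD(1)[OF f(1)] homogD[OF f(2)]
    by (simp add: H_lam_def psh_def) (simp add: v)
qed

lemma nonneg_psh_scale:
  assumes f: "nonneg_psh f" and c: "0 \<le> c"
  shows "nonneg_psh (\<lambda>z. c * f z)"
  unfolding nonneg_psh_def submean_def
proof (intro conjI allI)
  show "usc (\<lambda>z. c * f z)"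
    using nonneg_pshD[OF f] c by (intro usc_mult_nonneg usc_const) auto
  show "c * f a \<le> (\<integral>\<theta>. c * f (a + cis \<theta> *s b) \<partial>circ)" for a b
    using nonneg_pshD(3)[OF f] c by (simp add: mult_left_mono)
qed (use nonneg_pshD(1)[OF f] c in auto)

section \<open>Growth and zero sets of homogeneous functions\<close>

lemma norm_Phi_le:
  fixes lam :: "real^'n"
  assumes "\<And>k. l \<le> lam$k" "0 \<le> t"
  shows "norm (Phi lam z (of_real t)) \<le> exp (- l * t) * norm z"
proof -
  have "cmod (Phi lam z (of_real t) $ k) \<le> cmod ((of_real (exp (- l * t)) *s z) $ k)" for k
  proof -
    have "l * t \<le> lam$k * t" using assms by (intro mult_right_mono) auto
    then have "cmod (z$k) * exp (- (lam$k * t)) \<le> cmod (z$k) * exp (- (l * t))"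
      by (intro mult_left_mono) auto
    then show ?thesis by (simp add: Phi_def norm_mult mult.commute)
  qed
  then have "norm (Phi lam z (of_real t)) \<le> norm (of_real (exp (- l * t)) *s z)"
    unfolding norm_vec_def by (intro L2_set_mono) auto
  then show ?thesis by (simp only: norm_vector_smult norm_of_real abs_exp_cancel)
qed

text \<open>All exponents being positive, the flow at one fixed time carries the ball of radius
  \<open>R\<close> into the unit ball, at the price of a factor \<open>exp t\<close>. The constant
  depends only on \<open>lam\<close> and \<open>R\<close>, so it serves a whole family at
  once.\<close>

lemma homog_bounded_on_balls:
  fixes lam :: "real^'n"
  assumes lam: "\<forall>k. lam$k > 0"
  obtains K where "K \<ge> 1" "\<And>f M z. \<lbrakk>homog lam f; 0 \<le> M; \<And>z. norm z < 1 \<Longrightarrow> f z \<le> M; norm z \<le> R\<rbrakk> \<Longrightarrow> f z \<le> K * M"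
proof -
  define l where "l = Min (range (\<lambda>k. lam$k))"
  have l: "l \<le> lam$k" for k unfolding l_def by (intro Min_le) auto
  have "l \<in> range (\<lambda>k. lam$k)" unfolding l_def by (intro Min_in) auto
  then have l0: "l > 0" using lam by auto
  \<comment> \<open>At the slowest rate \<open>l\<close> this time contracts by
    \<open>exp (- (\<bar>R\<bar> + 1))\<close>, which beats \<open>\<bar>R\<bar>\<close>.\<close>
  define t where "t = (\<bar>R\<bar> + 1) / l"
  have t0: "t \<ge> 0" using l0 by (simp add: t_def)
  have tR: "exp (- l * t) * \<bar>R\<bar> < 1"
  proof -
    have "\<bar>R\<bar> < exp (\<bar>R\<bar> + 1)" using exp_ge_add_one_self[of "\<bar>R\<bar> + 1"] by linarith
    moreover have "- l * t = - (\<bar>R\<bar> + 1)" using l0 by (simp add: t_def)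
    ultimately show ?thesis by (simp only: exp_minus) (simp add: divide_simps)
  qed
  show ?thesis
  proof (rule that[of "exp t"])
    show "exp t \<ge> 1" using t0 by simp
    fix f and M :: real and z :: "complex^'n"
    assume f: "homog lam f" "0 \<le> M" "\<And>z. norm z < 1 \<Longrightarrow> f z \<le> M" "norm z \<le> R"
    have "norm (Phi lam z (of_real t)) \<le> exp (- l * t) * norm z" by (rule norm_Phi_le[OF l t0])
    also have "\<dots> \<le> exp (- l * t) * \<bar>R\<bar>" using f(4) by (intro mult_left_mono) auto
    finally have "norm (Phi lam z (of_real t)) < 1" using tR by linarith
    then have "f (Phi lam z (of_real t)) \<le> M" by (rule f(3))
    then show "f z \<le> exp t * M" using homogD[OF f(1), of z "of_real t"] by (simp add: exp_minus field_simps)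
  qed
qed

text \<open>The circle about \<open>w\<close> through \<open>a\<close> meets the ball in an arc of
  positive measure, on which \<open>- ln f\<close> is infinite. The supermean inequality then makes
  it infinite at the centre \<open>w\<close>.\<close>

lemma homog_psh_zero_if_zero_on_ball:
  fixes f :: "complex^'n \<Rightarrow> real"
  assumes f: "nonneg_psh f" "homog lam f" and r: "0 < r" and zero: "\<And>z. z \<in> ball a r \<Longrightarrow> f z = 0"
  shows "f w = 0"
proof -
  let ?c = "\<lambda>\<theta>. w + cis \<theta> *s (a - w)"
  obtain M where M: "\<And>\<theta>. f (?c \<theta>) \<le> M" using usc_circle_bounded[OF nonneg_pshD(2)[OF f(1)]] by blast
  define K where "K = max 0 M + 1"
  have K: "K > 0" "f (?c \<theta>) < K" for \<theta> using M[of \<theta>] by (auto simp: K_def)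
  have "continuous_on UNIV ?c" by (intro continuous_intros)
  then have "isCont ?c 0" by (simp add: continuous_on_eq_continuous_at)
  then obtain d where d: "d > 0" "\<And>\<theta>. \<bar>\<theta>\<bar> < d \<Longrightarrow> dist (?c \<theta>) (?c 0) < r"
    using r unfolding continuous_at_eps_delta by (auto simp: dist_real_def)
  \<comment> \<open>The cap \<open>1\<close> keeps the arc inside \<open>{0..2*pi}\<close>, the set
    that carries \<open>circ\<close>.\<close>
  define \<delta> where "\<delta> = min (d / 2) 1"
  have \<delta>: "0 < \<delta>" "\<delta> < d" "\<delta> \<le> 2 * pi" using d(1) pi_gt3 by (auto simp: \<delta>_def)
  have "\<infinity> * emeasure circ {0..\<delta>} = (\<integral>\<^sup>+\<theta>. \<infinity> * indicator {0..\<delta>} \<theta> \<partial>circ)"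
    by (rule nn_integral_cmult_indicator[symmetric]) simp
  also have "\<dots> \<le> (\<integral>\<^sup>+\<theta>. neglog (f (?c \<theta>) / K) \<partial>circ)"
  proof (rule nn_integral_mono)
    fix \<theta>
    show "\<infinity> * indicator {0..\<delta>} \<theta> \<le> neglog (f (?c \<theta>) / K)"
    proof (cases "\<theta> \<in> {0..\<delta>}")
      case True
      then have "dist (?c \<theta>) (?c 0) < r" using d(2)[of \<theta>] \<delta> by auto
      then have "?c \<theta> \<in> ball a r" by (simp add: dist_commute)
      then show ?thesis by (simp add: zero neglog_def)
    qed simp
  qed
  also have "\<dots> \<le> neglog (f w / K)" by (rule neglog_supermean[OF f K(2)])
  finally have "\<infinity> * emeasure circ {0..\<delta>} \<le> neglog (f w / K)" .
  moreover have "emeasure circ {0..\<delta>} \<noteq> 0"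
  proof -
    have "{0..2*pi} \<inter> {0..\<delta>} = {0..\<delta>}" using \<delta> by auto
    then have "emeasure circ {0..\<delta>} = ennreal \<delta> / ennreal (2 * pi)"
      unfolding circ_def using \<delta> by (subst emeasure_uniform_measure) auto
    then show ?thesis using \<delta> by (simp add: divide_ennreal)
  qed
  ultimately have "neglog (f w / K) = \<infinity>" by (simp add: ennreal_top_mult top_unique)
  then have "f w / K \<le> 0" by (auto simp: neglog_def split: if_splits)
  then show ?thesis using K(1) nonneg_pshD(1)[OF f(1), of w] by (simp add: divide_le_0_iff)
qed

lemma unbounded_family_pluripolar:
  fixes lam :: "real^'n" and f :: "'i \<Rightarrow> complex^'n \<Rightarrow> real"
  assumes lam: "\<forall>k. lam$k > 0"
    and f: "\<And>i. i \<in> I \<Longrightarrow> nonneg_psh (f i)" "\<And>i. i \<in> I \<Longrightarrow> homog lam (f i)"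
    and unb: "\<not> (\<exists>M. \<forall>z. norm z < 1 \<longrightarrow> (\<forall>i\<in>I. f i z \<le> M))"
  shows "lam_pluripolar lam {z. \<exists>U. \<forall>i\<in>I. f i z \<le> U}"
proof -
  have "\<exists>i x. i \<in> I \<and> norm x \<le> 1 \<and> (\<forall>z. norm z \<le> 1 \<longrightarrow> f i z \<le> f i x) \<and> exp (2^(j+1)) \<le> f i x" for j :: nat
  proof -
    obtain z i where zi: "norm z < 1" "i \<in> I" "exp (2^(j+1)) < f i z"
      using unb by (meson not_le)
    have "cball (0::complex^'n) 1 \<noteq> {}" by simp
    from usc_attains_sup[OF nonneg_pshD(2)[OF f(1)[OF zi(2)]] compact_cball this]
    obtain x where "norm x \<le> 1" "\<forall>z. norm z \<le> 1 \<longrightarrow> f i z \<le> f i x" by auto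
    then show ?thesis using zi by (intro exI[of _ i] exI[of _ x]) (auto intro: order_trans less_imp_le)
  qed
  then obtain i x where ix: "\<And>j::nat. i j \<in> I" "\<And>j. norm (x j) \<le> 1"
    "\<And>j z. norm z \<le> 1 \<Longrightarrow> f (i j) z \<le> f (i j) (x j)" "\<And>j. exp (2^(j+1)) \<le> f (i j) (x j)"
    by metis
  define M where "M = (\<lambda>j. f (i j) (x j))"
  have M0: "M j > 0" for j using less_le_trans[OF exp_gt_zero ix(4)] by (simp add: M_def)
  \<comment> \<open>After normalisation the maximum over the closed unit ball is exactly
    \<open>1\<close>, attained at \<open>x j\<close>. The upper bound \<open>1\<close> spreads to
    all balls by homogeneity, and the attained value keeps the infinite product from vanishing
    identically.\<close>
  define F where "F = (\<lambda>j z. inverse (M j) * f (i j) z)"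
  have hF: "homog lam (F j)" for j
    using homogD[OF f(2)[OF ix(1)]] by (simp add: F_def homog_def)
  have F1: "F j z \<le> 1" if "norm z \<le> 1" for j z
    using ix(3)[OF that, of j] M0[of j] by (simp add: F_def M_def field_simps)
  interpret product_sequence lam F
  proof
    show "nonneg_psh (F j)" for j
      unfolding F_def using M0[of j] by (intro nonneg_psh_scale f ix) auto
    show "homog lam (F j)" for j by (rule hF)
    show "\<exists>K\<ge>1. \<forall>j z. norm z \<le> R \<longrightarrow> F j z \<le> K" for R
    proof (rule homog_bounded_on_balls[OF lam, of R])
      fix K :: real
      assume K: "K \<ge> 1" "\<And>f M z. \<lbrakk>homog lam f; 0 \<le> M; \<And>z. norm z < 1 \<Longrightarrow> f z \<le> M; norm z \<le> R\<rbrakk> \<Longrightarrow> f z \<le> K * M"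
      have "F j z \<le> K * 1" if "norm z \<le> R" for j z
        by (rule K(2)[OF hF]) (use F1 that in auto)
      then show ?thesis using K(1) by (intro exI[of _ K]) auto
    qed
  qed
  have "\<exists>z. v z \<noteq> 0"
  proof (rule v_nonzero[of x])
    show "1 \<le> F j (x j)" for j using M0[of j] by (simp add: F_def M_def)
  qed (rule ix(2))
  then have "(\<lambda>z. ereal (v z)) \<in> H_lam lam"
    using H_lam_iff v_psh v_homog by blast
  moreover have "v z = 0" if U: "\<forall>i\<in>I. f i z \<le> U" for z U
  proof (rule v_zero[of "max U 0"])
    fix j
    have "F j z \<le> inverse (M j) * max U 0"
      unfolding F_def using U ix(1)[of j] M0[of j] by (intro mult_left_mono) (auto intro: le_max_iff_disj[THEN iffD2])
    also have "\<dots> \<le> exp (- (2^(j+1))) * max U 0"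
      using ix(4)[of j] unfolding exp_minus M_def by (intro mult_right_mono le_imp_inverse_le) auto
    finally show "F j z \<le> max U 0 * exp (- (2^(j+1)))" by (simp add: mult.commute)
  qed simp
  ultimately show ?thesis
    unfolding lam_pluripolar_def by (intro bexI[of _ "\<lambda>z. ereal (v z)"]) (auto simp: zero_ereal_def)
qed

section \<open>The regularized supremum\<close>

lemma continuous_on_Phi: "continuous_on UNIV (\<lambda>z. Phi lam z t)"
  unfolding Phi_def by (intro continuous_on_vec_lambda continuous_intros)

lemma le_usc_reg: "u z \<le> usc_reg u z"
proof (rule ccontr)
  assume "\<not> ?thesis"
  then have "Limsup (nhds z) u < u z" by (simp add: usc_reg_def)
  then have "\<forall>\<^sub>F w in nhds z. u w < u z" by (rule Limsup_lessD)
  then show False using eventually_nhds_x_imp_x by fastforce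
qed

text \<open>Local boundedness makes the regularisation real valued. Homogeneity survives because the
  flow acts by homeomorphisms, and the submean inequality by an argument along points
  \<open>w n\<close> tending to \<open>a\<close>; means are taken of \<open>g\<close>, so
  measurability of the unregularised supremum is never asked for.\<close>

lemma usc_reg_in_H_lam:
  fixes lam :: "real^'n" and f :: "'i \<Rightarrow> complex^'n \<Rightarrow> real"
  assumes I: "I \<noteq> {}"
    and f: "\<And>i. i \<in> I \<Longrightarrow> nonneg_psh (f i)" "\<And>i. i \<in> I \<Longrightarrow> homog lam (f i)"
    and nonzero: "\<exists>i\<in>I. \<exists>z. f i z \<noteq> 0"
    and bdd: "\<And>R. \<exists>K. \<forall>i\<in>I. \<forall>z. norm z \<le> R \<longrightarrow> f i z \<le> K"
  shows "usc_reg (\<lambda>z. SUP i\<in>I. ereal (f i z)) \<in> H_lam lam"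
proof -
  define u where "u = (\<lambda>z. SUP i\<in>I. ereal (f i z))"
  have fu: "ereal (f i z) \<le> u z" if "i \<in> I" for i z
    unfolding u_def using that by (rule SUP_upper)
  have u_le: "u z \<le> ereal c" if "\<And>i. i \<in> I \<Longrightarrow> f i z \<le> c" for z c
    unfolding u_def using that by (intro SUP_least) simp
  define g where "g = (\<lambda>z. real_of_ereal (usc_reg u z))"
  have reg_le: "usc_reg u z \<le> ereal c" if "\<forall>\<^sub>F w in nhds z. u w \<le> ereal c" for z c
    unfolding usc_reg_def by (rule Limsup_bounded[OF that])
  have near: "\<forall>\<^sub>F w in nhds z. norm w \<le> norm z + 1" for z :: "complex^'n"
    unfolding eventually_nhds_metric
  proof (intro exI[of _ 1] conjI allI impI)
    fix w assume "dist w z < 1"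
    then show "norm w \<le> norm z + 1"
      using norm_triangle_ineq[of z "w - z"] by (simp add: dist_norm)
  qed simp
  have reg_bdd: "usc_reg u z \<le> ereal K" if "\<forall>i\<in>I. \<forall>w. norm w \<le> R + 1 \<longrightarrow> f i w \<le> K" "norm z \<le> R" for z R K
    using near[of z] that by (intro reg_le) (auto elim!: eventually_mono intro!: u_le)
  have nn: "0 \<le> usc_reg u z" for z
  proof -
    obtain i where i: "i \<in> I" using I by blast
    have "0 \<le> ereal (f i z)" using nonneg_pshD(1)[OF f(1)[OF i]] by simp
    also have "\<dots> \<le> usc_reg u z" using fu[OF i] le_usc_reg order_trans by blast
    finally show ?thesis .
  qed
  have ug: "usc_reg u z = ereal (g z)" for z
  proof -
    obtain K where "\<forall>i\<in>I. \<forall>w. norm w \<le> norm z + 1 \<longrightarrow> f i w \<le> K" using bdd by blast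
    then have "usc_reg u z \<le> ereal K" by (rule reg_bdd) simp
    then show ?thesis using nn[of z] unfolding g_def by (cases "usc_reg u z") auto
  qed
  have g0: "0 \<le> g z" for z using nn[of z] by (simp add: ug)
  have fg: "f i z \<le> g z" if "i \<in> I" for i z
    using order_trans[OF fu[OF that] le_usc_reg[of u z]] by (simp add: ug)
  have us: "usc g"
    unfolding usc_def
  proof (intro allI impI)
    fix z c assume "g z < c"
    then obtain c' where c': "g z < c'" "c' < c" using dense by blast
    then have "Limsup (nhds z) u < ereal c'" using ug[of z] by (simp add: usc_reg_def)
    then have "\<forall>\<^sub>F w in nhds z. u w < ereal c'" by (rule Limsup_lessD)
    \<comment> \<open>A bound near \<open>z\<close> is also a bound near every point close to
      \<open>z\<close>, so it passes to the regularisation at those points.\<close>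
    then have "\<forall>\<^sub>F y in nhds z. \<forall>\<^sub>F w in nhds y. u w < ereal c'" by (simp only: eventually_eventually)
    then show "\<forall>\<^sub>F w in nhds z. g w < c"
    proof eventually_elim
      case (elim y)
      then have "usc_reg u y \<le> ereal c'" by (intro reg_le) (auto elim: eventually_mono)
      then show ?case using c'(2) by (simp add: ug)
    qed
  qed
  have appr: "\<exists>w i. dist w z < d \<and> i \<in> I \<and> c < f i w" if "c < g z" "d > 0" for c z d
  proof (rule ccontr)
    assume no: "\<not> ?thesis"
    have "\<forall>\<^sub>F w in nhds z. dist w z < d"
      using \<open>d > 0\<close> by (auto simp: eventually_nhds_metric)
    then have "\<forall>\<^sub>F w in nhds z. u w \<le> ereal c"
      by eventually_elim (use no not_less in \<open>blast intro: u_le\<close>)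
    then have "usc_reg u z \<le> ereal c" by (rule reg_le)
    with \<open>c < g z\<close> show False by (simp add: ug)
  qed
  \<comment> \<open>One inequality is enough, since the time \<open>- t\<close> yields the other. A
    point near \<open>Phi lam z t\<close> where some \<open>f i\<close> exceeds \<open>c\<close> is
    pulled back by the inverse flow, where upper semicontinuity of \<open>g\<close> forbids such a
    large value.\<close>
  have hom_le: "g (Phi lam z t) \<le> exp (- Re t) * g z" for z t
  proof (rule ccontr)
    assume "\<not> ?thesis"
    then obtain c where c: "exp (- Re t) * g z < c" "c < g (Phi lam z t)" using dense by (auto simp: not_le)
    have "g (Phi lam (Phi lam z t) (- t)) < exp (Re t) * c"
      unfolding Phi_inverse using c(1) by (simp add: exp_minus field_simps)
    then have "\<forall>\<^sub>F w in nhds (Phi lam z t). g (Phi lam w (- t)) < exp (Re t) * c"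
      by (rule uscD[OF usc_compose[OF us continuous_on_Phi]])
    then obtain d where d: "d > 0" "\<And>w. dist w (Phi lam z t) < d \<Longrightarrow> g (Phi lam w (- t)) < exp (Re t) * c"
      unfolding eventually_nhds_metric by blast
    obtain w i where wi: "dist w (Phi lam z t) < d" "i \<in> I" "c < f i w"
      using appr[OF c(2) d(1)] by blast
    have "exp (Re t) * f i w \<le> g (Phi lam w (- t))"
      using fg[OF wi(2), of "Phi lam w (- t)"] homogD[OF f(2)[OF wi(2)], of w "- t"] by simp
    also have "\<dots> < exp (Re t) * c" by (rule d(2)[OF wi(1)])
    finally show False using wi(3) by simp
  qed
  have hom: "homog lam g"
    unfolding homog_def
  proof (intro allI antisym hom_le)
    fix z t
    have "g z \<le> exp (Re t) * g (Phi lam z t)"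
      using hom_le[of "Phi lam z t" "- t"] by (simp add: Phi_inverse)
    then show "exp (- Re t) * g z \<le> g (Phi lam z t)" by (simp add: exp_minus field_simps)
  qed
  \<comment> \<open>For \<open>c < g a\<close>, members \<open>f (i n)\<close> exceed
    \<open>c\<close> at points \<open>w n\<close> tending to \<open>a\<close>. Their submean
    inequalities put \<open>c\<close> below the means of \<open>g\<close> over translated circles,
    and semicontinuity with Fatou's lemma moves these circles to the one about
    \<open>a\<close>.\<close>
  have "submean g"
    unfolding submean_def
  proof (intro allI)
    fix a b
    show "g a \<le> (\<integral>\<theta>. g (a + cis \<theta> *s b) \<partial>circ)"
    proof (rule dense_le)
      fix c assume c: "c < g a"
      define R where "R = norm a + norm b + 1"
      obtain K where K: "\<forall>i\<in>I. \<forall>w. norm w \<le> R + 1 \<longrightarrow> f i w \<le> K" using bdd by blast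
      have gK: "g z \<le> K" if "norm z \<le> R" for z using reg_bdd[OF K that] by (simp add: ug)
      have "\<exists>w i. dist w a < 1 / real (Suc n) \<and> i \<in> I \<and> c < f i w" for n
        by (rule appr[OF c]) simp
      then obtain w i where w: "\<And>n. dist (w n) a < 1 / real (Suc n)"
        and i: "\<And>n. i n \<in> I" "\<And>n. c < f (i n) (w n)" by metis
      have "norm (dist (w n) a) \<le> 1 / real (Suc n)" for n
        using less_imp_le[OF w[of n]] by (simp only: real_norm_def abs_of_nonneg zero_le_dist)
      then have "\<forall>\<^sub>F n in sequentially. norm (dist (w n) a) \<le> 1 / real (Suc n)" by simp
      from Lim_null_comparison[OF this lim_1_over_n[THEN LIMSEQ_Suc]]
      have wa: "w \<longlonglongrightarrow> a" unfolding tendsto_dist_iff[of w] .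
      have nw: "norm (w n + cis \<theta> *s b) \<le> R" for n \<theta>
      proof -
        have "1 / real (Suc n) \<le> 1" by simp
        then have "norm (w n - a) \<le> 1" using w[of n] unfolding dist_norm by linarith
        then have "norm (w n) \<le> norm a + 1" using norm_triangle_ineq[of a "w n - a"] by simp
        then show ?thesis using circle_in_cball[of "w n" \<theta> b] by (simp add: R_def)
      qed
      have na: "norm (a + cis \<theta> *s b) \<le> R" for \<theta>
        using circle_in_cball[of a \<theta> b] by (simp add: R_def)
      let ?G = "\<lambda>n \<theta>. g (w n + cis \<theta> *s b)" and ?g = "\<lambda>\<theta>. g (a + cis \<theta> *s b)"
      have int: "integrable circ (?G n)" "integrable circ ?g" for n
        by (rule usc_circle_integrable[OF us g0])+
      have cG: "c \<le> (\<integral>\<theta>. ?G n \<theta> \<partial>circ)" for n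
      proof -
        have "c \<le> f (i n) (w n)" using i(2)[of n] by simp
        also have "\<dots> \<le> (\<integral>\<theta>. f (i n) (w n + cis \<theta> *s b) \<partial>circ)"
          by (rule nonneg_pshD(3)[OF f(1)[OF i(1)]])
        also have "\<dots> \<le> (\<integral>\<theta>. ?G n \<theta> \<partial>circ)"
          using nonneg_pshD(1,2)[OF f(1)[OF i(1)[of n]]]
          by (intro integral_mono int usc_circle_integrable fg i) auto
        finally show ?thesis .
      qed
      \<comment> \<open>Subtracting from the common bound \<open>K\<close> makes the integrands
        nonnegative and turns upper into lower semicontinuity, the setting of Fatou's lemma.\<close>
      have nnint: "(\<integral>\<^sup>+\<theta>. ennreal (K - h \<theta>) \<partial>circ) = ennreal (K - (\<integral>\<theta>. h \<theta> \<partial>circ))"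
        if "integrable circ h" "\<And>\<theta>. h \<theta> \<le> K" for h
      proof -
        have "(\<integral>\<^sup>+\<theta>. ennreal (K - h \<theta>) \<partial>circ) = ennreal (\<integral>\<theta>. K - h \<theta> \<partial>circ)"
          using that by (intro nn_integral_eq_integral) auto
        then show ?thesis using that(1) by simp
      qed
      have "ennreal (K - (\<integral>\<theta>. ?g \<theta> \<partial>circ)) = (\<integral>\<^sup>+\<theta>. ennreal (K - ?g \<theta>) \<partial>circ)"
        using int(2) gK[OF na] by (rule nnint[symmetric])
      also have "\<dots> \<le> (\<integral>\<^sup>+\<theta>. liminf (\<lambda>n. ennreal (K - ?G n \<theta>)) \<partial>circ)"
      proof (rule nn_integral_mono, subst le_Liminf_iff, intro allI impI)
        fix \<theta> y assume y: "y < ennreal (K - ?g \<theta>)"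
        then obtain s where s: "y = ennreal s" "0 \<le> s" by (cases y) auto
        have "s < K - ?g \<theta>" using y s by (simp add: ennreal_less_iff)
        then have "g (a + cis \<theta> *s b) < K - s" by simp
        then have "\<forall>\<^sub>F x in nhds (a + cis \<theta> *s b). g x < K - s" by (rule uscD[OF us])
        moreover have "filterlim (\<lambda>n. w n + cis \<theta> *s b) (nhds (a + cis \<theta> *s b)) sequentially"
          by (intro tendsto_intros wa)
        ultimately have "\<forall>\<^sub>F n in sequentially. ?G n \<theta> < K - s"
          by (rule eventually_compose_filterlim)
        then show "\<forall>\<^sub>F n in sequentially. y < ennreal (K - ?G n \<theta>)"
          by eventually_elim (use s in \<open>simp add: ennreal_less_iff\<close>)
      qed
      also have "\<dots> \<le> liminf (\<lambda>n. \<integral>\<^sup>+\<theta>. ennreal (K - ?G n \<theta>) \<partial>circ)"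
        using usc_circle_measurable[OF us] by (intro nn_integral_liminf) simp
      also have "\<dots> = liminf (\<lambda>n. ennreal (K - (\<integral>\<theta>. ?G n \<theta> \<partial>circ)))"
        using nnint[OF int(1) gK[OF nw]] by simp
      also have "\<dots> \<le> ennreal (K - c)"
        using cG by (intro Liminf_le) (auto intro!: always_eventually ennreal_leI)
      finally have "ennreal (K - (\<integral>\<theta>. ?g \<theta> \<partial>circ)) \<le> ennreal (K - c)" .
      moreover have "norm a \<le> R" by (simp add: R_def)
      then have "0 \<le> K - c" using c gK[of a] by linarith
      ultimately show "c \<le> (\<integral>\<theta>. ?g \<theta> \<partial>circ)" by (simp add: ennreal_le_iff)
    qed
  qed
  then have "nonneg_psh g" using us g0 by (simp add: nonneg_psh_def)
  moreover have "\<exists>z. g z \<noteq> 0"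
  proof -
    obtain i z where "i \<in> I" "f i z \<noteq> 0" using nonzero by blast
    then have "g z > 0" using fg[of i z] nonneg_pshD(1)[OF f(1), of i z] by force
    then show ?thesis by (intro exI[of _ z]) simp
  qed
  ultimately have "usc_reg u \<in> H_lam lam"
    using hom ug H_lam_iff[of "usc_reg u" lam] by blast
  then show ?thesis by (simp only: u_def)
qed

lemma SUP_SUP_ereal_less_top_iff:
  fixes f :: "'i \<Rightarrow> 'a \<Rightarrow> real"
  assumes "\<And>i z. i \<in> I \<Longrightarrow> 0 \<le> f i z"
  shows "(SUP z\<in>B. SUP i\<in>I. ereal (f i z)) < \<infinity> \<longleftrightarrow> (\<exists>M. \<forall>z\<in>B. \<forall>i\<in>I. f i z \<le> M)"
proof
  assume fin: "(SUP z\<in>B. SUP i\<in>I. ereal (f i z)) < \<infinity>"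
  have le: "ereal (f i z) \<le> (SUP z\<in>B. SUP i\<in>I. ereal (f i z))" if "z \<in> B" "i \<in> I" for i z
    by (rule SUP_upper2[OF that(1)], rule SUP_upper[OF that(2)])
  show "\<exists>M. \<forall>z\<in>B. \<forall>i\<in>I. f i z \<le> M"
  proof (cases "SUP z\<in>B. SUP i\<in>I. ereal (f i z)")
    case (real M)
    then show ?thesis using le by (intro exI[of _ M]) (metis ereal_less_eq(3))
  next
    \<comment> \<open>As all values are nonnegative, this happens only when \<open>B\<close> or
      \<open>I\<close> is empty, and then any bound holds vacuously.\<close>
    case MInf
    then show ?thesis using le by (intro exI[of _ 0]) (metis MInfty_neq_ereal(2) ereal_infty_less_eq(2))
  qed (use fin in simp)
next
  assume "\<exists>M. \<forall>z\<in>B. \<forall>i\<in>I. f i z \<le> M"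
  then obtain M where "\<forall>z\<in>B. \<forall>i\<in>I. f i z \<le> M" ..
  then have "(SUP z\<in>B. SUP i\<in>I. ereal (f i z)) \<le> ereal M"
    by (intro SUP_least) simp
  then show "(SUP z\<in>B. SUP i\<in>I. ereal (f i z)) < \<infinity>" by (rule le_less_trans) simp
qed

theorem mainTheorem10:
  fixes lam :: "real^'n" and I :: "'i set" and us :: "'i \<Rightarrow> complex^'n \<Rightarrow> ereal"
    and u :: "complex^'n \<Rightarrow> ereal" and S :: "(complex^'n) set"
  assumes lam_pos: "\<forall>k. lam$k > 0" and lam_one: "\<exists>k. lam$k = 1"
    and I_ne: "I \<noteq> {}" and us_H: "\<forall>i\<in>I. us i \<in> H_lam lam"
    and u_def: "u = (\<lambda>z. SUP i\<in>I. us i z)"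
    and S_def: "S = {z. u z < \<infinity>}"
  shows "((SUP z\<in>ball 0 1. u z) < \<infinity> \<longleftrightarrow> usc_reg u \<in> H_lam lam)
       \<and> (usc_reg u \<in> H_lam lam \<longleftrightarrow> (\<exists>a. usc_reg u a < \<infinity>))
       \<and> ((\<exists>a. usc_reg u a < \<infinity>) \<longleftrightarrow> (\<exists>a r. r > 0 \<and> (SUP z\<in>ball a r. u z) < \<infinity>))
       \<and> ((\<exists>a r. r > 0 \<and> (SUP z\<in>ball a r. u z) < \<infinity>) \<longleftrightarrow> \<not> lam_pluripolar lam S)"
proof -
  have "\<forall>i\<in>I. \<exists>f. nonneg_psh f \<and> homog lam f \<and> (\<exists>z. f z \<noteq> 0) \<and> us i = (\<lambda>z. ereal (f z))"
    using us_H by (simp add: H_lam_iff)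
  from bchoice[OF this] obtain f where f: "\<And>i. i \<in> I \<Longrightarrow> nonneg_psh (f i)" "\<And>i. i \<in> I \<Longrightarrow> homog lam (f i)"
    "\<And>i. i \<in> I \<Longrightarrow> \<exists>z. f i z \<noteq> 0" "\<And>i. i \<in> I \<Longrightarrow> us i = (\<lambda>z. ereal (f i z))" by blast
  have u: "u = (\<lambda>z. SUP i\<in>I. ereal (f i z))"
    unfolding u_def using f(4) by (intro ext SUP_cong) auto
  have f0: "0 \<le> f i z" if "i \<in> I" for i z by (rule nonneg_pshD(1)[OF f(1)[OF that]])
  have SUP_iff: "(SUP z\<in>B. SUP i\<in>I. ereal (f i z)) < \<infinity> \<longleftrightarrow> (\<exists>M. \<forall>z\<in>B. \<forall>i\<in>I. f i z \<le> M)" for B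
    by (rule SUP_SUP_ereal_less_top_iff) (rule f0)
  have S: "S = {z. \<exists>U. \<forall>i\<in>I. f i z \<le> U}"
    using SUP_iff[of "{_}"] by (simp add: S_def u)
  let ?s1 = "(SUP z\<in>ball 0 1. u z) < \<infinity>" and ?s2 = "usc_reg u \<in> H_lam lam"
    and ?s3 = "\<exists>a. usc_reg u a < \<infinity>" and ?s4 = "\<exists>a r. r > 0 \<and> (SUP z\<in>ball a r. u z) < \<infinity>"
    and ?s5 = "\<not> lam_pluripolar lam S"
  \<comment> \<open>The equivalences follow from one cycle through the five conditions. Only the
    last two arrows use logarithmic plurisubharmonicity: vanishing on a ball for \<open>s45\<close>,
    the infinite product for \<open>s51\<close>.\<close>
  have s12: ?s2 if s1: ?s1
  proof -
    obtain M where "\<forall>z\<in>ball 0 1. \<forall>i\<in>I. f i z \<le> M"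
      using s1 unfolding u SUP_iff by blast
    then have M: "f i z \<le> M" if "norm z < 1" "i \<in> I" for z i using that by simp
    have "\<exists>K. \<forall>i\<in>I. \<forall>z. norm z \<le> R \<longrightarrow> f i z \<le> K" for R
    proof (rule homog_bounded_on_balls[OF lam_pos, of R])
      fix K :: real
      assume K: "\<And>f M z. \<lbrakk>homog lam f; 0 \<le> M; \<And>z. norm z < 1 \<Longrightarrow> f z \<le> M; norm z \<le> R\<rbrakk> \<Longrightarrow> f z \<le> K * M"
      have "f i z \<le> K * max M 0" if i: "i \<in> I" and z: "norm z \<le> R" for i z
        by (rule K[OF f(2)[OF i] _ _ z]) (use M[OF _ i] in \<open>auto simp: le_max_iff_disj\<close>)
      then show ?thesis by blast
    qed
    then show ?thesis
      unfolding u using I_ne f by (intro usc_reg_in_H_lam) auto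
  qed
  have s23: ?s3 if s2: ?s2
    using s2 by (auto simp: H_lam_def psh_def)
  have s34: ?s4 if s3: ?s3
  proof -
    obtain a where "usc_reg u a < \<infinity>" using s3 by blast
    then obtain c where "usc_reg u a < ereal c" using less_PInf_Ex_of_nat ereal_dense2 by blast
    then have "\<forall>\<^sub>F w in nhds a. u w < ereal c" unfolding usc_reg_def by (rule Limsup_lessD)
    then obtain r where r: "r > 0" "\<And>w. dist w a < r \<Longrightarrow> u w < ereal c" unfolding eventually_nhds_metric by blast
    have "(SUP z\<in>ball a r. u z) \<le> ereal c"
      using r(2) by (intro SUP_least less_imp_le) (simp add: dist_commute)
    then have "(SUP z\<in>ball a r. u z) < \<infinity>" by (rule le_less_trans) simp
    with r(1) show ?thesis by blast
  qed
  have s45: ?s5 if s4: ?s4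
  proof
    obtain a r where r: "r > 0" and "(SUP z\<in>ball a r. u z) < \<infinity>" using s4 by blast
    then have ball: "ball a r \<subseteq> S" unfolding u SUP_iff S by blast
    assume "lam_pluripolar lam S"
    then obtain v where "v \<in> H_lam lam" "S \<subseteq> {z. v z = 0}" unfolding lam_pluripolar_def by blast
    then obtain h where h: "nonneg_psh h" "homog lam h" "\<exists>z. h z \<noteq> 0" "S \<subseteq> {z. h z = 0}"
      unfolding H_lam_iff by (auto simp: zero_ereal_def)
    have "h w = 0" for w
      by (rule homog_psh_zero_if_zero_on_ball[OF h(1,2) r]) (use ball h(4) in blast)
    with h(3) show False by blast
  qed
  have s51: ?s1 if ?s5
  proof (rule ccontr)
    assume "\<not> ?s1"
    then have "\<not> (\<exists>M. \<forall>z. norm z < 1 \<longrightarrow> (\<forall>i\<in>I. f i z \<le> M))"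
      unfolding u SUP_iff Ball_def mem_ball_0 by blast
    then have "lam_pluripolar lam S"
      unfolding S by (intro unbounded_family_pluripolar lam_pos f)
    with that show False ..
  qed
  show ?thesis using s12 s23 s34 s45 s51 by blast
qed

end
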